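(* Let $p>1$ and $p'=\frac{p}{p-1}$. Assume that $0\le a\in L^1(\Omega)$ is a non-trivial function (i.e. $a\not\equiv 0$) and that $f\in L^{p'}(\Omega)$. Then there exists $\mu_{0^*}>0$ such that, for all $0<\mu\le\mu_{0^*}$, the problem $$-\Delta_p u+\frac{a(x)}{u}=\mu f(x)\ \text{ in }\Omega,\qquad u=0\ \text{ on }\partial\Omega \tag{P}$$ does not admit any non-trivial finite energy solution $u\in W^{1,p}_0(\Omega)$.
   Context: $\Omega\subset\mathbb{R}^N$ ($N\ge2$) is a bounded open set with smooth boundary and $\Delta_p u=\operatorname{div}(|\nabla u|^{p-2}\nabla u)$. For $k>0$, $T_k(s)=\max(-k,\min(s,k))$. Generalized gradient: if $u$ is measurable with $T_k(u)\in W^{1,1}_{\rm loc}(\Omega)$ for every $k>0$, then $\nabla u$ denotes the a.e. unique measurable vector field $v$ with $\nabla T_k(u)=v\chi_{\{|u|\le k\}}$ a.e. in $\Omega$ for every $k>0$. Solution: a nonnegative measurable function $u$ is a (distributional) solution of (P) if $T_k(u)\in W^{1,1}_0(\Omega)$ for every $k>0$, both $|\nabla u|^{p-1}$ and $au^{-1}$ belong to $L^1_{\rm loc}(\Omega)$, and $$\int_\Omega|\nabla u|^{p-2}\nabla u\cdot\nabla\varphi+\int_\Omega\frac{a\varphi}{u}=\mu\int_\Omega f\varphi\quad\text{for all }\varphi\in C^1_c(\Omega).$$ Here $a/u$ is understood as $+\infty$ where $u=0<a$ and as $0$ where $a=0$. A finite energy solution is a solution that belongs to $W^{1,p}_0(\Omega)$.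 *)

theory Defs
  imports "HOL-Analysis.Analysis"
begin

fun Ck_on :: "nat \<Rightarrow> 'a::real_normed_vector set \<Rightarrow> ('a \<Rightarrow> real) \<Rightarrow> bool" where
  "Ck_on 0 S f \<longleftrightarrow> continuous_on S f"
| "Ck_on (Suc k) S f \<longleftrightarrow>
     (\<forall>x\<in>S. f differentiable (at x)) \<and>
     (\<forall>v. Ck_on k S (\<lambda>x. frechet_derivative f (at x) v))"

definition grad :: "('a::euclidean_space \<Rightarrow> real) \<Rightarrow> 'a \<Rightarrow> 'a" where
  "grad f x = (\<Sum>b\<in>Basis. frechet_derivative f (at x) b *\<^sub>R b)"

lemma GDERIV_grad:
  fixes f :: "'a::euclidean_space \<Rightarrow> real"
  assumes "f differentiable (at x)"
  shows "GDERIV f x :> grad f x"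
proof -
  let ?D = "frechet_derivative f (at x)"
  have D: "(f has_derivative ?D) (at x)"
    using assms frechet_derivative_works by blast
  then interpret bounded_linear ?D
    by (rule has_derivative_bounded_linear)
  have "?D h = h \<bullet> grad f x" for h
  proof -
    have "?D h = ?D (\<Sum>b\<in>Basis. (h \<bullet> b) *\<^sub>R b)"
      by (simp add: euclidean_representation)
    also have "\<dots> = (\<Sum>b\<in>Basis. (h \<bullet> b) * ?D b)"
      by (simp add: sum scaleR)
    also have "\<dots> = h \<bullet> grad f x"
      by (simp add: grad_def inner_sum_right mult.commute)
    finally show ?thesis .
  qed
  then have "?D = (\<lambda>h. h \<bullet> grad f x)" by blast
  with D show ?thesis by (simp add: gderiv_def)
qed

text \<open>
  Near each boundary point, the set lies above the graph of a smooth function over the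
  hyperplane orthogonal to some unit vector \<open>e\<close>. The function is evaluated only at the
  projection \<open>x - (x \<bullet> e) e\<close>, so letting it be defined on the whole space instead of the
  hyperplane changes nothing.
\<close>

definition smooth_boundary :: "'a::euclidean_space set \<Rightarrow> bool" where
  "smooth_boundary \<Omega> \<longleftrightarrow>
     (\<forall>x0\<in>frontier \<Omega>. \<exists>r>0. \<exists>e \<gamma>. norm e = 1 \<and> (\<forall>k. Ck_on k UNIV \<gamma>) \<and>
        \<Omega> \<inter> ball x0 r = {x \<in> ball x0 r. \<gamma> (x - (x \<bullet> e) *\<^sub>R e) < x \<bullet> e})"

text \<open>Compactly supported functions on an open set are identified with their extensions by zero.\<close>

definition Cc_one :: "'a::euclidean_space set \<Rightarrow> ('a \<Rightarrow> real) set" where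
  "Cc_one \<Omega> = {\<phi>. Ck_on 1 UNIV \<phi> \<and>
     compact (closure {x. \<phi> x \<noteq> 0}) \<and> closure {x. \<phi> x \<noteq> 0} \<subseteq> \<Omega>}"

definition Cc_infty :: "'a::euclidean_space set \<Rightarrow> ('a \<Rightarrow> real) set" where
  "Cc_infty \<Omega> = {\<phi>. (\<forall>k. Ck_on k UNIV \<phi>) \<and>
     compact (closure {x. \<phi> x \<noteq> 0}) \<and> closure {x. \<phi> x \<noteq> 0} \<subseteq> \<Omega>}"

definition in_Lp :: "real \<Rightarrow> 'a::euclidean_space set \<Rightarrow> ('a \<Rightarrow> 'b::euclidean_space) \<Rightarrow> bool" where
  "in_Lp q \<Omega> f \<longleftrightarrow> f \<in> borel_measurable (lebesgue_on \<Omega>) \<and>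
     integrable (lebesgue_on \<Omega>) (\<lambda>x. norm (f x) powr q)"

definition Lp_norm :: "real \<Rightarrow> 'a::euclidean_space set \<Rightarrow> ('a \<Rightarrow> 'b::euclidean_space) \<Rightarrow> real" where
  "Lp_norm q \<Omega> f = (LINT x|lebesgue_on \<Omega>. norm (f x) powr q) powr (1 / q)"

definition in_L1_loc :: "'a::euclidean_space set \<Rightarrow> ('a \<Rightarrow> 'b::euclidean_space) \<Rightarrow> bool" where
  "in_L1_loc \<Omega> f \<longleftrightarrow> f \<in> borel_measurable (lebesgue_on \<Omega>) \<and>
     (\<forall>K. compact K \<and> K \<subseteq> \<Omega> \<longrightarrow> integrable (lebesgue_on K) f)"

text \<open>\<open>u \<in> W\<^sup>1\<^sup>,\<^sup>1\<^sub>l\<^sub>o\<^sub>c(\<Omega>)\<close> with weak gradient \<open>g\<close>.\<close>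

definition has_weak_gradient ::
  "'a::euclidean_space set \<Rightarrow> ('a \<Rightarrow> real) \<Rightarrow> ('a \<Rightarrow> 'a) \<Rightarrow> bool" where
  "has_weak_gradient \<Omega> u g \<longleftrightarrow> in_L1_loc \<Omega> u \<and> in_L1_loc \<Omega> g \<and>
     (\<forall>\<phi>\<in>Cc_infty \<Omega>.
        (LINT x|lebesgue_on \<Omega>. u x *\<^sub>R grad \<phi> x) = - (LINT x|lebesgue_on \<Omega>. \<phi> x *\<^sub>R g x))"

text \<open>\<open>W\<^sup>1\<^sup>,\<^sup>q\<^sub>0(\<Omega>)\<close>, the closure of the test functions in \<open>W\<^sup>1\<^sup>,\<^sup>q(\<Omega>)\<close>.\<close>

definition in_W1_0 :: "real \<Rightarrow> 'a::euclidean_space set \<Rightarrow> ('a \<Rightarrow> real) \<Rightarrow> bool" where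
  "in_W1_0 q \<Omega> u \<longleftrightarrow> in_Lp q \<Omega> u \<and>
     (\<exists>g. has_weak_gradient \<Omega> u g \<and> in_Lp q \<Omega> g \<and>
       (\<exists>\<phi>. (\<forall>n. \<phi> n \<in> Cc_infty \<Omega>) \<and>
         (\<lambda>n::nat. Lp_norm q \<Omega> (\<lambda>x. \<phi> n x - u x)) \<longlonglongrightarrow> 0 \<and>
         (\<lambda>n. Lp_norm q \<Omega> (\<lambda>x. grad (\<phi> n) x - g x)) \<longlonglongrightarrow> 0))"

definition trunc :: "real \<Rightarrow> real \<Rightarrow> real" where
  "trunc k s = max (- k) (min s k)"

definition has_gen_gradient ::
  "'a::euclidean_space set \<Rightarrow> ('a \<Rightarrow> real) \<Rightarrow> ('a \<Rightarrow> 'a) \<Rightarrow> bool" where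
  "has_gen_gradient \<Omega> u v \<longleftrightarrow>
     u \<in> borel_measurable (lebesgue_on \<Omega>) \<and> v \<in> borel_measurable (lebesgue_on \<Omega>) \<and>
     (\<forall>k>0. has_weak_gradient \<Omega> (\<lambda>x. trunc k (u x)) (\<lambda>x. indicator {y. \<bar>u y\<bar> \<le> k} x *\<^sub>R v x))"

text \<open>
  Division in \<^typ>\<open>ennreal\<close> satisfies \<open>c / 0 = \<infinity>\<close> for \<open>c > 0\<close> and \<open>0 / c = 0\<close> for every \<open>c\<close>
  (also \<open>c = 0\<close>), unlike division in \<^typ>\<open>real\<close>.
\<close>

definition sing_quot :: "('a \<Rightarrow> real) \<Rightarrow> ('a \<Rightarrow> real) \<Rightarrow> 'a \<Rightarrow> ennreal" where
  "sing_quot a u x = ennreal (a x) / ennreal (u x)"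

lemma sing_quot_simps:
  "0 < a x \<Longrightarrow> u x = 0 \<Longrightarrow> sing_quot a u x = \<infinity>"
  "a x = 0 \<Longrightarrow> sing_quot a u x = 0"
  "0 \<le> a x \<Longrightarrow> 0 < u x \<Longrightarrow> sing_quot a u x = ennreal (a x / u x)"
  by (auto simp: sing_quot_def divide_ennreal ennreal_divide_eq_top_iff)

text \<open>
  The generalized gradient is unique up to null sets, and no condition below depends on the
  representative \<open>v\<close>. Where \<open>v x = 0\<close> the field \<open>|v|\<^sup>p\<^sup>-\<^sup>2 v\<close> vanishes, also for \<open>p < 2\<close>.
  Passing to \<^const>\<open>enn2real\<close> is harmless, since local integrability makes the
  quotient finite almost everywhere.
\<close>

definition is_solution ::
  "real \<Rightarrow> 'a::euclidean_space set \<Rightarrow> ('a \<Rightarrow> real) \<Rightarrow> ('a \<Rightarrow> real) \<Rightarrow> real \<Rightarrow> ('a \<Rightarrow> real) \<Rightarrow> bool"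
where
  "is_solution p \<Omega> a f \<mu> u \<longleftrightarrow>
     u \<in> borel_measurable (lebesgue_on \<Omega>) \<and>
     (AE x in lebesgue_on \<Omega>. 0 \<le> u x) \<and>
     (\<forall>k>0. in_W1_0 1 \<Omega> (\<lambda>x. trunc k (u x))) \<and>
     (\<forall>K. compact K \<and> K \<subseteq> \<Omega> \<longrightarrow> (\<integral>\<^sup>+x. sing_quot a u x \<partial>lebesgue_on K) < \<infinity>) \<and>
     (\<exists>v. has_gen_gradient \<Omega> u v \<and>
        in_L1_loc \<Omega> (\<lambda>x. norm (v x) powr (p - 1)) \<and>
        (\<forall>\<phi>\<in>Cc_one \<Omega>.
           (LINT x|lebesgue_on \<Omega>. (norm (v x) powr (p - 2) *\<^sub>R v x) \<bullet> grad \<phi> x)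
           + (LINT x|lebesgue_on \<Omega>. enn2real (sing_quot a u x) * \<phi> x)
           = \<mu> * (LINT x|lebesgue_on \<Omega>. f x * \<phi> x)))"

definition is_finite_energy_solution ::
  "real \<Rightarrow> 'a::euclidean_space set \<Rightarrow> ('a \<Rightarrow> real) \<Rightarrow> ('a \<Rightarrow> real) \<Rightarrow> real \<Rightarrow> ('a \<Rightarrow> real) \<Rightarrow> bool"
where
  "is_finite_energy_solution p \<Omega> a f \<mu> u \<longleftrightarrow> is_solution p \<Omega> a f \<mu> u \<and> in_W1_0 p \<Omega> u"

end

theory Submission
  imports Defs
begin

text \<open>
  Testing the equation with the solution \<open>u\<close> itself turns it into the energy identity
  \<open>\<integral> |\<nabla>u|\<^sup>p + \<integral> a = \<mu> \<integral> f u\<close>: local integrability of \<open>a/u\<close> forces \<open>u > 0\<close> almost everywhere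
  on \<open>{a > 0}\<close>, so \<open>(a/u) u = a\<close>. The right-hand side is controlled by Young's inequality and by
  Poincare's inequality, and the gradient part of the bound can be absorbed on the left. What
  remains is \<open>\<integral> a \<le> C \<mu>\<^sup>q \<integral> |f|\<^sup>q\<close> with \<open>q = p/(p - 1)\<close> and \<open>C\<close> independent of \<open>u\<close> and \<open>\<mu>\<close>
  (\<open>integral_coefficient_bound\<close>). Since \<open>\<integral> a > 0\<close>, this is impossible for small \<open>\<mu>\<close>.

  Only functions of class \<open>C\<^sup>1\<close> with compact support are admissible in the equation, so \<open>u\<close> is
  replaced by \<open>\<psi>\<^sub>n = G\<^sub>n(\<phi>\<^sub>n)\<close>, where \<open>\<phi>\<^sub>n\<close> are test functions converging to \<open>u\<close> in \<open>W\<^sup>1\<^sup>,\<^sup>p\<close> and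
  \<open>G\<^sub>n\<close> is a \<open>C\<^sup>1\<close> approximation of the positive part with \<open>0 \<le> G\<^sub>n' \<le> 1\<close> (\<open>smooth_pos\<close>). As
  \<open>\<psi>\<^sub>n \<ge> 0\<close>, Fatou's lemma bounds \<open>\<integral> a\<close> by the lower limit of \<open>\<integral> (a/u) \<psi>\<^sub>n\<close>. For each fixed \<open>n\<close>
  all other terms are compared with the weighted energy \<open>\<integral> G\<^sub>n'(\<phi>\<^sub>n) |\<nabla>u|\<^sup>p\<close>, which cancels, up to
  a multiple of \<open>\<integral> |\<nabla>\<phi>\<^sub>n - \<nabla>u|\<^sup>p\<close> (\<open>energy_test_estimate\<close>). The weight has to be kept, since
  \<open>G\<^sub>n'(\<phi>\<^sub>n)\<close> need not converge to \<open>1\<close> where \<open>u = 0\<close>. The absorption rests on two pointwise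
  inequalities for powers (\<open>powr_absorb\<close>, \<open>powr_absorb_conjugate\<close>).

  The equation is formulated with the generalized gradient of \<open>u\<close>, whereas the approximation
  concerns the weak gradient. The two agree (\<open>gen_gradient_eq_weak_gradient\<close>): by the chain
  rule for \<open>u - max 0 (u - k)\<close> both, cut off outside \<open>{u \<le> k}\<close>, are weak gradients of the
  truncation of \<open>u\<close> at height \<open>k\<close>, and weak gradients are unique by the fundamental lemma of
  the calculus of variations, for which smooth bump functions on boxes are constructed.
\<close>

section \<open>Smooth bump functions on boxes\<close>

lemma frechet_derivative_eq:
  assumes "(f has_derivative f') (at x)"
  shows "frechet_derivative f (at x) = f'"
  using frechet_derivative_at[OF assms] by simp

lemma Ck_on_Suc_imp:
  fixes f :: "'a::euclidean_space \<Rightarrow> real"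
  shows "Ck_on (Suc k) UNIV f \<Longrightarrow> Ck_on k UNIV f"
proof (induction k arbitrary: f)
  case 0
  then show ?case
    by (auto intro!: continuous_at_imp_continuous_on differentiable_imp_continuous_within)
next
  case (Suc k)
  then show ?case by auto
qed

lemma Ck_on_const: "Ck_on k UNIV (\<lambda>x::'a::euclidean_space. c)"
  by (induction k arbitrary: c) (auto simp: frechet_derivative_const)

lemma Ck_on_add:
  fixes f g :: "'a::euclidean_space \<Rightarrow> real"
  shows "Ck_on k UNIV f \<Longrightarrow> Ck_on k UNIV g \<Longrightarrow> Ck_on k UNIV (\<lambda>x. f x + g x)"
proof (induction k arbitrary: f g)
  case 0
  then show ?case by (auto intro: continuous_intros)
next
  case (Suc k)
  have "frechet_derivative (\<lambda>x. f x + g x) (at x) v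
      = frechet_derivative f (at x) v + frechet_derivative g (at x) v" for x v
    by (subst frechet_derivative_eq[OF has_derivative_add])
       (use Suc.prems in \<open>auto simp: frechet_derivative_works\<close>)
  then show ?case using Suc by auto
qed

lemma Ck_on_mult:
  fixes f g :: "'a::euclidean_space \<Rightarrow> real"
  shows "Ck_on k UNIV f \<Longrightarrow> Ck_on k UNIV g \<Longrightarrow> Ck_on k UNIV (\<lambda>x. f x * g x)"
proof (induction k arbitrary: f g)
  case 0
  then show ?case by (auto intro: continuous_intros)
next
  case (Suc k)
  have "frechet_derivative (\<lambda>x. f x * g x) (at x) v
      = f x * frechet_derivative g (at x) v + frechet_derivative f (at x) v * g x" for x v
    by (subst frechet_derivative_eq[OF has_derivative_mult])
       (use Suc.prems in \<open>auto simp: frechet_derivative_works\<close>)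
  moreover have "Ck_on k UNIV f" "Ck_on k UNIV g"
    using Suc.prems Ck_on_Suc_imp by blast+
  ultimately show ?case using Suc by (auto intro!: Ck_on_add)
qed

lemma Ck_on_prod:
  fixes f :: "'i \<Rightarrow> 'a::euclidean_space \<Rightarrow> real"
  assumes "\<And>i. i \<in> I \<Longrightarrow> Ck_on k UNIV (f i)"
  shows "Ck_on k UNIV (\<lambda>x. \<Prod>i\<in>I. f i x)"
  using assms
  by (induction I rule: infinite_finite_induct) (auto intro: Ck_on_const Ck_on_mult)

lemma Ck_on_affine:
  fixes v :: "'a::euclidean_space"
  shows "Ck_on k UNIV (\<lambda>x. x \<bullet> v + c)"
proof (cases k)
  case 0
  then show ?thesis by (auto intro!: continuous_intros)
next
  case (Suc m)
  have D: "((\<lambda>x. x \<bullet> v + c) has_derivative (\<lambda>h. h \<bullet> v)) (at x)" for x :: 'a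
    by (auto intro!: derivative_eq_intros)
  then show ?thesis
    using Suc by (auto simp: frechet_derivative_eq[OF D] Ck_on_const differentiable_def)
qed

text \<open>
  The powers of \<open>t\<close> in the denominator make the family closed under differentiation, so that
  smoothness can be proved for all members at once. The parameter \<open>c\<close> is sent to \<open>0\<close> later,
  which lets the profile with \<open>m = 0\<close> increase to the indicator function of \<open>{0<..}\<close>.
\<close>

definition bump_profile :: "real \<Rightarrow> nat \<Rightarrow> real \<Rightarrow> real" where
  "bump_profile c m t = (if t \<le> 0 then 0 else exp (- c / t) / t ^ m)"

text \<open>
  At \<open>t = 0\<close> both terms vanish, and the claim is that \<open>exp (- c / t)\<close> decays faster than every
  power of \<open>t\<close> as \<open>t\<close> tends to \<open>0\<close> from above.
\<close>

lemma bump_profile_deriv: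
  assumes "c > 0"
  shows "(bump_profile c m has_real_derivative
    c * bump_profile c (m + 2) t - real m * bump_profile c (m + 1) t) (at t)"
proof -
  consider "t < 0" | "t = 0" | "t > 0" by linarith
  then show ?thesis
  proof cases
    case 1
    have "((\<lambda>t. 0) has_real_derivative 0) (at t)" by simp
    moreover have "bump_profile c (m+2) t = 0" "bump_profile c (m+1) t = 0"
      using 1 by (auto simp: bump_profile_def)
    moreover have "\<forall>\<^sub>F s in nhds t. bump_profile c m s = 0"
      using eventually_nhds_in_open[of "{..<0}" t] 1
      by (auto simp: bump_profile_def elim!: eventually_mono)
    ultimately show ?thesis
      by (subst DERIV_cong_ev[OF refl _ refl, of _ "\<lambda>_. 0"]) auto
  next
    case 2
    have "((\<lambda>s. bump_profile c m s / s) \<longlongrightarrow> 0) (at_right 0)"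
    proof (rule Lim_transform_eventually)
      show "((\<lambda>s. exp (- c / s) / s ^ m / s) \<longlongrightarrow> 0) (at_right 0)"
      proof -
        have "((\<lambda>y::real. (c * y) ^ Suc m / exp (c * y) / c ^ Suc m) \<longlongrightarrow> 0 / c ^ Suc m) at_top"
          by (intro tendsto_divide filterlim_compose[OF tendsto_power_div_exp_0]
              filterlim_tendsto_pos_mult_at_top[OF tendsto_const] filterlim_ident tendsto_const)
             (use assms in auto)
        then have "((\<lambda>s::real. (c * inverse s) ^ Suc m / exp (c * inverse s) / c ^ Suc m) \<longlongrightarrow> 0)
            (at_right 0)"
          using filterlim_compose[OF _ filterlim_inverse_at_top_right] by force
        then show ?thesis
          using assms by (simp add: field_simps exp_minus power_mult_distrib)
      qed
      show "\<forall>\<^sub>F s in at_right 0. exp (- c / s) / s ^ m / s = bump_profile c m s / s"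
        using eventually_at_right_less[of "0::real"]
        by (auto simp: bump_profile_def elim!: eventually_mono)
    qed
    moreover have "((\<lambda>s. bump_profile c m s / s) \<longlongrightarrow> 0) (at_left 0)"
    proof (rule Lim_transform_eventually)
      show "((\<lambda>s::real. 0::real) \<longlongrightarrow> 0) (at_left 0)" by simp
      have "\<forall>\<^sub>F s in at_left 0. s < (0::real)"
        by (simp add: eventually_at_filter)
      then show "\<forall>\<^sub>F s in at_left 0. 0 = bump_profile c m s / s"
        by (auto simp: bump_profile_def elim!: eventually_mono)
    qed
    ultimately have "((\<lambda>s. bump_profile c m s / s) \<longlongrightarrow> 0) (at 0)"
      by (simp add: filterlim_split_at)
    then have "(bump_profile c m has_real_derivative 0) (at 0)"
      by (simp add: DERIV_def bump_profile_def)
    then show ?thesis using 2 by (simp add: bump_profile_def)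
  next
    case 3
    have "((\<lambda>t. exp (- c / t) / t ^ m) has_real_derivative
      c * (exp (- c / t) / t ^ (m + 2)) - real m * (exp (- c / t) / t ^ (m + 1))) (at t)"
    proof -
      have E: "((\<lambda>t. exp (- c / t)) has_real_derivative exp (- c / t) * (c / t ^ 2)) (at t)"
        using DERIV_fun_exp[OF DERIV_cmult[OF DERIV_inverse[of t UNIV], of "- c"]] 3
        by (simp add: divide_inverse power2_eq_square)
      have P: "((\<lambda>t. inverse (t ^ m)) has_real_derivative - real m * inverse (t ^ (m + 1))) (at t)"
      proof -
        have eq: "- (inverse (t ^ m) * (real m * t ^ (m - Suc 0)) * inverse (t ^ m))
            = - real m * inverse (t ^ (m + 1))"
          using 3 by (cases m) (auto simp: field_simps)
        then show ?thesis
          using DERIV_inverse'[OF DERIV_pow[of m t UNIV]] 3 unfolding eq by auto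
      qed
      show ?thesis
        using DERIV_mult[OF E P] 3 by (simp add: divide_inverse algebra_simps power_add power2_eq_square)
    qed
    moreover have "bump_profile c j t = exp (- c / t) / t ^ j" for j
      using 3 by (auto simp: bump_profile_def)
    moreover have "\<forall>\<^sub>F s in nhds t. bump_profile c m s = exp (- c / s) / s ^ m"
      using eventually_nhds_in_open[of "{0<..}" t] 3
      by (auto simp: bump_profile_def elim!: eventually_mono)
    ultimately show ?thesis
      by (subst DERIV_cong_ev[OF refl _ refl]) auto
  qed
qed

text \<open>
  Differentiating a composition with a profile yields a derivative of the inner function times
  profiles with larger exponents, so induction on the order of differentiability works with the
  exponent \<open>m\<close> left arbitrary.
\<close>

lemma Ck_on_bump_profile:
  fixes A :: "'a::euclidean_space \<Rightarrow> real"
  assumes "c > 0" and A: "\<And>k. Ck_on k UNIV A"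
  shows "Ck_on k UNIV (\<lambda>x. bump_profile c m (A x))"
proof (induction k arbitrary: m)
  case 0
  have "continuous_on UNIV (bump_profile c m)"
    using bump_profile_deriv[OF \<open>c > 0\<close>]
    by (meson DERIV_isCont continuous_at_imp_continuous_on)
  then show ?case
    using A[of 0] continuous_on_compose2[of UNIV "bump_profile c m" UNIV A] by simp
next
  case (Suc k)
  have D: "((\<lambda>x. bump_profile c m (A x)) has_derivative
      (\<lambda>v. frechet_derivative A (at x) v *
        (c * bump_profile c (m + 2) (A x) + (- real m) * bump_profile c (m + 1) (A x)))) (at x)" for x
  proof -
    have "(A has_derivative frechet_derivative A (at x)) (at x)"
      using A[of 1] by (auto simp: frechet_derivative_works)
    from DERIV_compose_FDERIV[OF bump_profile_deriv[OF \<open>c > 0\<close>] this]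
    show ?thesis by simp
  qed
  have "Ck_on k UNIV (\<lambda>x. frechet_derivative A (at x) v)" for v
    using A[of "Suc k"] by simp
  then show ?case
    unfolding Ck_on.simps frechet_derivative_eq[OF D]
    by (intro conjI ballI allI Ck_on_mult Ck_on_add Ck_on_const Suc.IH differentiableI[OF D])
qed

text \<open>
  The negated basis vector in the second factor gives both factors the form of an affine
  function \<open>x \<bullet> v + c\<close> inside a profile.
\<close>

definition box_bump :: "'a::euclidean_space \<Rightarrow> 'a \<Rightarrow> real \<Rightarrow> 'a \<Rightarrow> real" where
  "box_bump l r c x =
    (\<Prod>b\<in>Basis. bump_profile c 0 (x \<bullet> b + - (l \<bullet> b)) * bump_profile c 0 (x \<bullet> (- b) + r \<bullet> b))"

lemma box_bump_nonzero_iff: "box_bump l r c x \<noteq> 0 \<longleftrightarrow> x \<in> box l r"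
  by (auto simp: box_bump_def bump_profile_def mem_box not_le)

lemma box_bump_bounds: "c > 0 \<Longrightarrow> 0 \<le> box_bump l r c x \<and> box_bump l r c x \<le> 1"
  unfolding box_bump_def
  by (intro conjI prod_nonneg prod_le_1)
     (auto simp: bump_profile_def intro!: mult_le_one divide_nonneg_nonneg)

lemma box_bump_Cc_infty:
  assumes "c > 0" "cbox l r \<subseteq> \<Omega>"
  shows "box_bump l r c \<in> Cc_infty \<Omega>"
proof -
  have "Ck_on k UNIV (box_bump l r c)" for k
    unfolding box_bump_def using assms(1)
    by (intro Ck_on_prod Ck_on_mult Ck_on_bump_profile Ck_on_affine)
  moreover have "closure {x. box_bump l r c x \<noteq> 0} \<subseteq> cbox l r"
    unfolding box_bump_nonzero_iff by (rule closure_minimal) (auto simp: mem_box less_imp_le)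
  ultimately show ?thesis
    using assms(2) bounded_subset[OF bounded_cbox]
    unfolding Cc_infty_def by (auto simp: compact_eq_bounded_closed)
qed

lemma box_bump_tendsto:
  "(\<lambda>n. box_bump l r (inverse (real (Suc n))) x) \<longlonglongrightarrow> indicator (box l r) x"
proof (cases "x \<in> box l r")
  case True
  have "(\<lambda>n. bump_profile (inverse (real (Suc n))) 0 t) \<longlonglongrightarrow> 1" if "t > 0" for t
  proof -
    have "(\<lambda>n. exp (- inverse (real (Suc n)) / t)) \<longlonglongrightarrow> exp (- 0 / t)"
      by (intro tendsto_intros LIMSEQ_inverse_real_of_nat) (use that in auto)
    then show ?thesis using that by (simp add: bump_profile_def)
  qed
  then have "(\<lambda>n. box_bump l r (inverse (real (Suc n))) x) \<longlonglongrightarrow> (\<Prod>b\<in>(Basis::'a set). 1 * 1)"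
    unfolding box_bump_def using True
    by (intro tendsto_prod tendsto_mult) (auto simp: mem_box)
  then show ?thesis using True by simp
next
  case False
  then have "box_bump l r c x = 0" for c
    using box_bump_nonzero_iff by blast
  then show ?thesis using False by simp
qed

section \<open>The fundamental lemma of the calculus of variations\<close>

lemma AE_lebesgue_on_iff:
  "S \<in> sets lebesgue \<Longrightarrow> (AE x in lebesgue_on S. P x) \<longleftrightarrow> (AE x in lebesgue. x \<in> S \<longrightarrow> P x)"
  by (subst AE_restrict_space_iff) auto

text \<open>
  By Lebesgue differentiation along the boxes with lower left corner \<open>x\<close>, almost every value
  \<open>w x\<close> is a limit of averages, and these averages vanish.
\<close>

lemma negligible_nonzero_if_box_integrals_eq_0:
  fixes w :: "'a::euclidean_space \<Rightarrow> 'b::euclidean_space"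
  assumes int: "w integrable_on cbox l r"
    and zero: "\<And>a b. cbox a b \<subseteq> cbox l r \<Longrightarrow> integral (cbox a b) w = 0"
  shows "negligible {x \<in> cbox l r. w x \<noteq> 0}"
proof -
  \<comment> \<open>The differentiation theorem needs integrability on all boxes, hence the extension by zero.\<close>
  define f where "f x = (if x \<in> cbox l r then w x else 0)" for x
  have "f integrable_on UNIV"
    using int by (simp add: f_def[abs_def] integrable_restrict_UNIV)
  then have "f integrable_on cbox a b" for a b
    by (rule integrable_on_subcbox) simp
  then obtain N where N: "negligible N"
    "\<And>x e. x \<notin> N \<Longrightarrow> 0 < e \<Longrightarrow> \<exists>d>0. \<forall>h. 0 < h \<and> h < d \<longrightarrow>
      norm (integral (cbox x (x + h *\<^sub>R One)) f /\<^sub>R h ^ DIM('a) - f x) < e"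
    using integrable_ccontinuous_explicit[of f] by blast
  have "w x = 0" if x: "x \<in> box l r" "x \<notin> N" for x
  proof (rule ccontr)
    assume "w x \<noteq> 0"
    then obtain d where d: "d > 0" "\<And>h. 0 < h \<and> h < d \<Longrightarrow>
      norm (integral (cbox x (x + h *\<^sub>R One)) f /\<^sub>R h ^ DIM('a) - f x) < norm (w x)"
      using N(2)[OF x(2), of "norm (w x)"] by auto
    have "\<forall>\<^sub>F h in at_right 0. \<forall>b\<in>Basis. x \<bullet> b + h < r \<bullet> b"
    proof (subst eventually_ball_finite_distrib, simp, intro ballI)
      fix b :: 'a assume "b \<in> Basis"
      then have "0 < r \<bullet> b - x \<bullet> b"
        using x by (auto simp: mem_box)
      from eventually_at_right_real[OF this]
      show "\<forall>\<^sub>F h in at_right 0. x \<bullet> b + h < r \<bullet> b"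
        by (rule eventually_mono) auto
    qed
    moreover have "\<forall>\<^sub>F h in at_right 0. h \<in> {0<..<d}"
      using eventually_at_right_real d(1) by blast
    ultimately have "\<forall>\<^sub>F h in at_right 0. h \<in> {0<..<d} \<and> (\<forall>b\<in>Basis. x \<bullet> b + h < r \<bullet> b)"
      by (rule eventually_conj[rotated])
    then obtain h where h: "0 < h" "h < d" "\<forall>b\<in>Basis. x \<bullet> b + h < r \<bullet> b"
      using eventually_happens[of _ "at_right (0::real)"] by (auto simp: trivial_limit_at_right_real)
    have sub: "cbox x (x + h *\<^sub>R One) \<subseteq> cbox l r"
    proof
      fix y assume y: "y \<in> cbox x (x + h *\<^sub>R One)"
      have "l \<bullet> b \<le> y \<bullet> b \<and> y \<bullet> b \<le> r \<bullet> b" if b: "b \<in> Basis" for b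
        using h(3) x(1) y b by (force simp: mem_box inner_add_left)
      then show "y \<in> cbox l r" by (simp add: mem_box)
    qed
    have "integral (cbox x (x + h *\<^sub>R One)) f = integral (cbox x (x + h *\<^sub>R One)) w"
      using sub by (intro integral_cong) (auto simp: f_def)
    moreover have "f x = w x"
      using x(1) box_subset_cbox[of l r] by (auto simp: f_def)
    ultimately show False
      using d(2)[of h] h(1,2) zero[OF sub] by simp
  qed
  then have "{x \<in> cbox l r. w x \<noteq> 0} \<subseteq> N \<union> (cbox l r - box l r)"
    by blast
  then show ?thesis
    by (rule negligible_subset[OF negligible_Un[OF N(1) negligible_frontier_interval]])
qed

text \<open>
  Testing with bump functions that increase to the indicator function of a box shows that \<open>w\<close>
  has integral zero over every box in \<open>\<Omega>\<close>; then countably many boxes exhaust \<open>\<Omega>\<close>.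
\<close>

lemma fundamental_lemma_calculus_variations:
  fixes w :: "'a::euclidean_space \<Rightarrow> 'b::euclidean_space"
  assumes "open \<Omega>" and w: "in_L1_loc \<Omega> w"
    and zero: "\<And>\<phi>. \<phi> \<in> Cc_infty \<Omega> \<Longrightarrow> (LINT x|lebesgue_on \<Omega>. \<phi> x *\<^sub>R w x) = 0"
  shows "AE x in lebesgue_on \<Omega>. w x = 0"
proof -
  have int: "integrable (lebesgue_on (cbox l r)) w" if "cbox l r \<subseteq> \<Omega>" for l r
    using w that by (auto simp: in_L1_loc_def)
  have box0: "integral (cbox l r) w = 0" if sub: "cbox l r \<subseteq> \<Omega>" for l r
  proof -
    define W where "W x = indicator (cbox l r) x *\<^sub>R w x" for x
    define s where "s n x = box_bump l r (inverse (real (Suc n))) x *\<^sub>R W x" for n x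
    have W: "integrable lebesgue W"
      using int[OF sub] unfolding W_def[abs_def] by (subst (asm) integrable_restrict_space) auto
    have meas: "(\<lambda>x. s n x) \<in> borel_measurable lebesgue" for n
    proof -
      have "Ck_on 0 UNIV (box_bump l r (inverse (real (Suc n))))"
        using box_bump_Cc_infty[OF _ sub, of "inverse (real (Suc n))"] by (auto simp: Cc_infty_def)
      then have "box_bump l r (inverse (real (Suc n))) \<in> borel_measurable lebesgue"
        by (auto intro!: measurable_completion borel_measurable_continuous_onI)
      then show ?thesis unfolding s_def using W by (intro borel_measurable_scaleR) auto
    qed
    have "(\<lambda>n. LINT x|lebesgue. s n x) \<longlonglongrightarrow> (LINT x|lebesgue. indicator (box l r) x *\<^sub>R W x)"
    proof (rule integral_dominated_convergence[where w = "\<lambda>x. norm (W x)"])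
      show "AE x in lebesgue. (\<lambda>n. s n x) \<longlonglongrightarrow> indicator (box l r) x *\<^sub>R W x"
        unfolding s_def by (intro AE_I2 tendsto_intros box_bump_tendsto)
      show "AE x in lebesgue. norm (s n x) \<le> norm (W x)" for n
        using box_bump_bounds[of "inverse (real (Suc n))" l r]
        by (intro AE_I2) (auto simp: s_def intro!: mult_left_le_one_le)
    qed (use W meas in \<open>auto intro!: borel_measurable_scaleR borel_measurable_indicator\<close>)
    moreover have "(LINT x|lebesgue. s n x) = 0" for n
    proof -
      have "(LINT x|lebesgue. s n x)
          = (LINT x|lebesgue. indicator \<Omega> x *\<^sub>R (box_bump l r (inverse (real (Suc n))) x *\<^sub>R w x))"
        using box_bump_nonzero_iff[of l r "inverse (real (Suc n))"] sub box_subset_cbox[of l r]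
        by (intro Bochner_Integration.integral_cong)
           (auto simp: s_def W_def indicator_def split: if_splits)
      also have "\<dots> = 0"
        using zero[OF box_bump_Cc_infty[OF _ sub, of "inverse (real (Suc n))"]] \<open>open \<Omega>\<close>
        by (subst integral_restrict_space[symmetric]) auto
      finally show ?thesis .
    qed
    ultimately have "(LINT x|lebesgue. indicator (box l r) x *\<^sub>R W x) = 0"
      by (simp add: LIMSEQ_const_iff)
    also have boxW: "(\<lambda>x. indicator (box l r) x *\<^sub>R W x) = (\<lambda>x. indicator (box l r) x *\<^sub>R w x)"
      using box_subset_cbox[of l r] by (auto simp: W_def indicator_def fun_eq_iff)
    finally have "(LINT x|lebesgue_on (box l r). w x) = 0"
      by (subst integral_restrict_space) auto
    moreover have "integrable (lebesgue_on (box l r)) w"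
    proof (subst integrable_restrict_space)
      have "integrable lebesgue (\<lambda>x. indicator (box l r) x *\<^sub>R W x)"
        using W by (rule integrable_mult_indicator[rotated]) auto
      then show "integrable lebesgue (\<lambda>x. indicator (box l r) x *\<^sub>R w x)"
        unfolding boxW .
    qed auto
    ultimately show ?thesis
      by (simp add: lebesgue_integral_eq_integral integral_open_interval)
  qed
  have neg: "negligible {x \<in> cbox l r. w x \<noteq> 0}" if sub: "cbox l r \<subseteq> \<Omega>" for l r
  proof (rule negligible_nonzero_if_box_integrals_eq_0)
    show "w integrable_on cbox l r"
      using int[OF sub] by (simp add: integrable_on_lebesgue_on)
    show "integral (cbox a b) w = 0" if "cbox a b \<subseteq> cbox l r" for a b
      using box0 that sub by blast
  qed
  obtain \<D> where D: "countable \<D>" "\<D> \<subseteq> Pow \<Omega>"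
    "\<And>X. X \<in> \<D> \<Longrightarrow> \<exists>a b. X = cbox a b" "\<Union>\<D> = \<Omega>"
    using open_countable_Union_open_cbox[OF \<open>open \<Omega>\<close>] by blast
  have "negligible (\<Union>X\<in>\<D>. {x \<in> X. w x \<noteq> 0})"
    using D neg by (intro negligible_countable_Union) (auto, blast)
  moreover have "(\<Union>X\<in>\<D>. {x \<in> X. w x \<noteq> 0}) = {x \<in> \<Omega>. w x \<noteq> 0}"
    using D(4) by auto
  ultimately have "{x \<in> \<Omega>. w x \<noteq> 0} \<in> null_sets lebesgue"
    by (simp add: negligible_iff_null_sets)
  then show ?thesis
    using \<open>open \<Omega>\<close> by (subst AE_lebesgue_on_iff) (auto dest!: AE_not_in elim!: eventually_mono)
qed

section \<open>Continuously differentiable functions with compact support\<close>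

lemma grad_eq:
  assumes "(f has_derivative (\<lambda>h. h \<bullet> g)) (at x)"
  shows "grad f x = g"
  unfolding grad_def frechet_derivative_eq[OF assms]
  using euclidean_representation[of g] by (simp add: inner_commute)

lemma has_derivative_grad:
  assumes "Ck_on 1 UNIV f"
  shows "(f has_derivative (\<lambda>h. h \<bullet> grad f x)) (at x)"
  using assms GDERIV_grad[of f x] by (auto simp: gderiv_def)

text \<open>
  A \<open>C\<^sup>1\<close> function is handled through its gradient field from here on. This is the
  introduction rule, and \<open>has_derivative_grad\<close> and \<open>continuous_on_grad\<close> are the
  eliminations.
\<close>

lemma Ck_on_1I:
  assumes "\<And>x. (f has_derivative (\<lambda>h. h \<bullet> g x)) (at x)" "continuous_on UNIV g"
  shows "Ck_on 1 UNIV f"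
  unfolding One_nat_def Ck_on.simps frechet_derivative_eq[OF assms(1)]
  using assms by (auto intro!: continuous_intros intro: differentiableI)

lemma continuous_on_grad: "Ck_on 1 UNIV f \<Longrightarrow> continuous_on UNIV (grad f)"
  unfolding grad_def[abs_def] by (auto intro!: continuous_intros)

lemma Ck_on_1_continuous:
  fixes f :: "'a::euclidean_space \<Rightarrow> real"
  shows "Ck_on 1 UNIV f \<Longrightarrow> continuous_on UNIV f"
  using Ck_on_Suc_imp[of 0 f] by simp

lemma grad_mult:
  assumes "Ck_on 1 UNIV f" "Ck_on 1 UNIV g"
  shows "grad (\<lambda>x. f x * g x) x = f x *\<^sub>R grad g x + g x *\<^sub>R grad f x"
  by (rule grad_eq)
     (rule has_derivative_eq_rhs[OF has_derivative_mult[OF has_derivative_grad[OF assms(1)]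
        has_derivative_grad[OF assms(2)]]], auto simp: algebra_simps inner_add_right)

lemma C1_compose_real:
  assumes "Ck_on 1 UNIV f" "\<And>t. (H has_real_derivative H' t) (at t)" "continuous_on UNIV H'"
  shows "Ck_on 1 UNIV (\<lambda>x. H (f x))" and "grad (\<lambda>x. H (f x)) x = H' (f x) *\<^sub>R grad f x"
proof -
  have D: "((\<lambda>x. H (f x)) has_derivative (\<lambda>h. h \<bullet> (H' (f x) *\<^sub>R grad f x))) (at x)" for x
    using DERIV_compose_FDERIV[OF assms(2) has_derivative_grad[OF assms(1)]]
    by (simp add: mult.commute)
  show "Ck_on 1 UNIV (\<lambda>x. H (f x))"
    using continuous_on_compose2[OF assms(3) Ck_on_1_continuous[OF assms(1)]]
      continuous_on_grad[OF assms(1)]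
    by (intro Ck_on_1I[OF D]) (auto intro!: continuous_intros)
  show "grad (\<lambda>x. H (f x)) x = H' (f x) *\<^sub>R grad f x"
    by (rule grad_eq[OF D])
qed

lemma grad_eq_0_outside:
  assumes "x \<notin> closure {x. f x \<noteq> 0}"
  shows "grad f x = 0"
proof -
  have "\<forall>\<^sub>F y in nhds x. f y = 0"
    using assms eventually_nhds_in_open[OF open_Compl[OF closed_closure], of x "{x. f x \<noteq> 0}"] closure_subset[of "{x. f x \<noteq> 0}"]
    by (auto elim!: eventually_mono)
  moreover from this have "f x = 0"
    by (rule eventually_nhds_x_imp_x)
  ultimately have "(f has_derivative (\<lambda>h. 0)) (at x)"
    by (subst has_derivative_transform_eventually[of "\<lambda>_. 0" "\<lambda>_. 0" x UNIV f])
       (auto simp: eventually_at_filter elim!: eventually_mono)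
  then show ?thesis by (intro grad_eq) simp
qed

lemma Cc_infty_imp_one: "\<phi> \<in> Cc_infty \<Omega> \<Longrightarrow> \<phi> \<in> Cc_one \<Omega>"
  unfolding Cc_infty_def Cc_one_def by blast

lemma Cc_one_compose:
  assumes "\<phi> \<in> Cc_one \<Omega>" "\<And>t. (H has_real_derivative H' t) (at t)" "continuous_on UNIV H'" "H 0 = 0"
  shows "(\<lambda>x. H (\<phi> x)) \<in> Cc_one \<Omega>"
proof -
  have "{x. H (\<phi> x) \<noteq> 0} \<subseteq> {x. \<phi> x \<noteq> 0}"
    using assms(4) by auto
  then have "closure {x. H (\<phi> x) \<noteq> 0} \<subseteq> closure {x. \<phi> x \<noteq> 0}"
    by (rule closure_mono)
  moreover from this have "compact (closure {x. H (\<phi> x) \<noteq> 0})"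
    using assms(1) by (auto simp: Cc_one_def compact_eq_bounded_closed intro: bounded_subset)
  ultimately show ?thesis
    using assms C1_compose_real(1)[OF _ assms(2,3), of \<phi>] unfolding Cc_one_def by auto
qed

lemma integrable_continuous_bounded_support:
  fixes f :: "'a::euclidean_space \<Rightarrow> 'b::euclidean_space"
  assumes f: "continuous_on UNIV f" and K: "bounded K" "\<And>x. x \<notin> K \<Longrightarrow> f x = 0"
  shows "integrable lborel f" "integrable lebesgue f"
    and "S \<in> sets lebesgue \<Longrightarrow> integrable (lebesgue_on S) f"
proof -
  obtain R where R: "K \<subseteq> cball 0 R"
    using K(1) unfolding bounded_pos by (force simp: subset_iff)
  have "integrable lborel (\<lambda>x. indicator (cball 0 R) x *\<^sub>R f x)"
    by (rule borel_integrable_compact) (use f continuous_on_subset in auto)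
  also have "(\<lambda>x. indicator (cball 0 R) x *\<^sub>R f x) = f"
    using R K(2) by (force simp: indicator_def)
  finally show 1: "integrable lborel f" .
  then show 2: "integrable lebesgue f"
    by (subst integrable_completion) auto
  show "integrable (lebesgue_on S) f" if "S \<in> sets lebesgue"
    using that integrable_mult_indicator[OF that 2] by (subst integrable_restrict_space) auto
qed

text \<open>
  By translation invariance the integral of \<open>F(x + t b)\<close> does not depend on \<open>t\<close>, so the
  difference quotients of \<open>F\<close> in direction \<open>b\<close> have integral zero. They converge to the partial
  derivative and are dominated, by the mean value theorem and the bounded support.
\<close>

lemma integral_grad_eq_0:
  fixes F :: "'a::euclidean_space \<Rightarrow> real"
  assumes F: "Ck_on 1 UNIV F" and bdd: "bounded {x. F x \<noteq> 0}"
  shows "(LINT x|lebesgue. grad F x) = 0"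
proof -
  have contF: "continuous_on UNIV F" and contG: "continuous_on UNIV (grad F)"
    using F by (simp_all add: Ck_on_1_continuous continuous_on_grad)
  obtain R where R: "closure {x. F x \<noteq> 0} \<subseteq> cball 0 R"
    using bounded_closure[OF bdd] unfolding bounded_pos by (force simp: subset_iff)
  have F0: "F x = 0" and G0: "grad F x = 0" if "x \<notin> cball 0 R" for x
  proof -
    have "x \<notin> closure {x. F x \<noteq> 0}" using that R by blast
    then show "F x = 0" "grad F x = 0"
      using closure_subset[of "{x. F x \<noteq> 0}"] grad_eq_0_outside[of x F] by blast+
  qed
  have "compact (grad F ` cball 0 R)"
    using contG by (intro compact_continuous_image) (auto intro: continuous_on_subset)
  then obtain M where M: "M > 0" "\<And>x. x \<in> cball 0 R \<Longrightarrow> norm (grad F x) \<le> M"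
    by (auto dest!: compact_imp_bounded simp: bounded_pos)
  have GM: "norm (grad F x) \<le> M" for x
    using M G0[of x] by (cases "x \<in> cball 0 R") auto
  have intF: "integrable lborel F"
    by (rule integrable_continuous_bounded_support(1)[OF contF bounded_cball F0])
  have intG: "integrable lborel (grad F)"
    by (rule integrable_continuous_bounded_support(1)[OF contG bounded_cball G0])
  have [measurable]: "F \<in> borel_measurable borel" "grad F \<in> borel_measurable borel"
    using contF contG by (auto intro: borel_measurable_continuous_onI)
  have "(LINT x|lborel. grad F x) \<bullet> b = 0" if b: "b \<in> Basis" for b
  proof -
    define t where "t n = inverse (real (Suc n))" for n
    define q where "q n x = (F (t n *\<^sub>R b + x) - F x) / t n" for n x
    have t: "0 < t n" "t n \<le> 1" for n
      by (auto simp: t_def inverse_le_1_iff)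
    have line: "((\<lambda>s. F (s *\<^sub>R b + x)) has_real_derivative grad F (s *\<^sub>R b + x) \<bullet> b) (at s)" for x s
    proof -
      have "((\<lambda>s. s *\<^sub>R b + x) has_derivative (\<lambda>h. h *\<^sub>R b)) (at s)"
        by (auto intro!: derivative_eq_intros)
      from has_derivative_compose[OF this has_derivative_grad[OF F]]
      show ?thesis by (simp add: has_field_derivative_def inner_commute mult.commute[of _ "_ \<bullet> _"])
    qed
    have "(\<lambda>n. LINT x|lborel. q n x) \<longlonglongrightarrow> (LINT x|lborel. grad F x \<bullet> b)"
    proof (rule integral_dominated_convergence[where w = "\<lambda>x. M * indicator (cball 0 (R + 1)) x"])
      show "AE x in lborel. (\<lambda>n. q n x) \<longlonglongrightarrow> grad F x \<bullet> b"
      proof (rule AE_I2)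
        fix x
        have "((\<lambda>s. (F (s *\<^sub>R b + x) - F x) / s) \<longlongrightarrow> grad F x \<bullet> b) (at 0)"
          using line[of x 0] by (simp add: DERIV_def)
        moreover have "filterlim t (at 0) sequentially"
          using t(1) LIMSEQ_inverse_real_of_nat by (auto simp: filterlim_at t_def[abs_def])
        ultimately show "(\<lambda>n. q n x) \<longlonglongrightarrow> grad F x \<bullet> b"
          unfolding q_def by (rule filterlim_compose)
      qed
      show "AE x in lborel. norm (q n x) \<le> M * indicator (cball 0 (R + 1)) x" for n
      proof (rule AE_I2)
        fix x
        show "norm (q n x) \<le> M * indicator (cball 0 (R + 1)) x"
        proof (cases "x \<in> cball 0 (R + 1)")
          case True
          obtain z where z: "F (t n *\<^sub>R b + x) - F (0 *\<^sub>R b + x)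
              = (t n - 0) * (grad F (z *\<^sub>R b + x) \<bullet> b)"
            using MVT2[OF t(1) line] by blast
          have "\<bar>grad F (z *\<^sub>R b + x) \<bullet> b\<bar> \<le> M"
            using Basis_le_norm[OF b] GM order_trans by blast
          moreover have "q n x = grad F (z *\<^sub>R b + x) \<bullet> b"
            using z t(1)[of n] by (simp add: q_def)
          ultimately show ?thesis using True by simp
        next
          case False
          have "norm x \<le> norm (t n *\<^sub>R b + x) + norm (t n *\<^sub>R b)"
            by (metis add.commute add_diff_cancel_left' norm_triangle_ineq4)
          then have "F (t n *\<^sub>R b + x) = 0" "F x = 0"
            using False t[of n] b by (auto intro!: F0)
          then show ?thesis using False by (simp add: q_def)
        qed
      qed
      show "integrable lborel (\<lambda>x. M * indicator (cball 0 (R + 1)) (x::'a))"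
        using emeasure_lborel_cball_finite[of "0::'a" "R + 1"]
        by (intro integrable_mult_right integrable_real_indicator) auto
    qed (auto simp: q_def)
    moreover have "(LINT x|lborel. q n x) = 0" for n
    proof -
      have "integrable lborel (\<lambda>x. F (t n *\<^sub>R b + x))"
        using intF lborel_distr_plus[of "t n *\<^sub>R b"]
        by (intro integrable_distr[of "(+) (t n *\<^sub>R b)" lborel borel F]) auto
      moreover have "(LINT x|lborel. F (t n *\<^sub>R b + x)) = (LINT x|lborel. F x)"
        using integral_distr[of "(+) (t n *\<^sub>R b)" lborel borel F] lborel_distr_plus[of "t n *\<^sub>R b"] by simp
      ultimately show ?thesis
        unfolding q_def using intF by simp
    qed
    ultimately have "(LINT x|lborel. grad F x \<bullet> b) = 0"
      by (simp add: LIMSEQ_const_iff)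
    then show ?thesis using intG by simp
  qed
  then have "(LINT x|lborel. grad F x) = 0"
    by (intro euclidean_eqI[of _ "0::'a"]) simp
  then show ?thesis by (subst integral_completion) auto
qed

lemma
  assumes "\<phi> \<in> Cc_one \<Omega>"
  shows Cc_one_C1: "Ck_on 1 UNIV \<phi>"
    and Cc_one_outside: "x \<notin> \<Omega> \<Longrightarrow> \<phi> x = 0"
    and Cc_one_grad_outside: "x \<notin> \<Omega> \<Longrightarrow> grad \<phi> x = 0"
    and Cc_one_bounded_support: "bounded {x. \<phi> x \<noteq> 0}"
    and Cc_one_bounded: "\<exists>M>0. \<forall>x. \<bar>\<phi> x\<bar> \<le> M \<and> norm (grad \<phi> x) \<le> M"
proof -
  define K where "K = closure {x. \<phi> x \<noteq> 0}"
  have K: "compact K" "K \<subseteq> \<Omega>" "Ck_on 1 UNIV \<phi>"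
    using assms by (auto simp: Cc_one_def K_def)
  show "Ck_on 1 UNIV \<phi>" by fact
  have 0: "\<phi> x = 0" "grad \<phi> x = 0" if "x \<notin> K" for x
    using that grad_eq_0_outside[of x \<phi>] closure_subset[of "{x. \<phi> x \<noteq> 0}"] by (auto simp only: K_def)
  show "x \<notin> \<Omega> \<Longrightarrow> \<phi> x = 0" "x \<notin> \<Omega> \<Longrightarrow> grad \<phi> x = 0"
    using 0 K by auto
  show "bounded {x. \<phi> x \<noteq> 0}"
    using K(1) bounded_subset[OF compact_imp_bounded closure_subset] unfolding K_def by blast
  have "compact (\<phi> ` K)" "compact (grad \<phi> ` K)"
    using K(1) continuous_on_subset[OF Ck_on_1_continuous[OF K(3)] subset_UNIV]
      continuous_on_subset[OF continuous_on_grad[OF K(3)] subset_UNIV]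
    by (blast intro: compact_continuous_image)+
  then obtain M N where "M > 0" "N > 0" "\<forall>x\<in>K. norm (\<phi> x) \<le> M" "\<forall>x\<in>K. norm (grad \<phi> x) \<le> N"
    by (auto dest!: compact_imp_bounded simp: bounded_pos)
  then have "\<forall>x. \<bar>\<phi> x\<bar> \<le> max M N \<and> norm (grad \<phi> x) \<le> max M N"
    using 0 by (metis abs_zero le_max_iff_disj norm_zero order_less_imp_le real_norm_def)
  then show "\<exists>M>0. \<forall>x. \<bar>\<phi> x\<bar> \<le> M \<and> norm (grad \<phi> x) \<le> M"
    using \<open>M > 0\<close> less_max_iff_disj by blast
qed

text \<open>
  The product \<open>h \<phi>\<close> has compact support although \<open>h\<close> need not, so the integral of its
  gradient vanishes.
\<close>

lemma integral_by_parts: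
  fixes \<phi> h :: "'a::euclidean_space \<Rightarrow> real"
  assumes "open \<Omega>" and \<phi>: "\<phi> \<in> Cc_one \<Omega>" and h: "Ck_on 1 UNIV h"
  shows "(LINT x|lebesgue_on \<Omega>. h x *\<^sub>R grad \<phi> x) = - (LINT x|lebesgue_on \<Omega>. \<phi> x *\<^sub>R grad h x)"
proof -
  let ?K = "closure {x. \<phi> x \<noteq> 0}"
  have C: "Ck_on 1 UNIV \<phi>" "bounded ?K"
    using \<phi> by (auto simp: Cc_one_def compact_imp_bounded)
  have cont: "continuous_on UNIV h" "continuous_on UNIV \<phi>"
    "continuous_on UNIV (grad h)" "continuous_on UNIV (grad \<phi>)"
    using h C(1) by (simp_all add: Ck_on_1_continuous continuous_on_grad)
  have 0: "x \<notin> ?K \<Longrightarrow> \<phi> x = 0" for x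
    using closure_subset[of "{x. \<phi> x \<noteq> 0}"] by auto
  have int1: "integrable lebesgue (\<lambda>x. h x *\<^sub>R grad \<phi> x)"
  proof (rule integrable_continuous_bounded_support(2)[OF _ C(2)])
    show "continuous_on UNIV (\<lambda>x. h x *\<^sub>R grad \<phi> x)"
      by (intro continuous_on_scaleR cont)
  qed (simp add: grad_eq_0_outside)
  have int2: "integrable lebesgue (\<lambda>x. \<phi> x *\<^sub>R grad h x)"
  proof (rule integrable_continuous_bounded_support(2)[OF _ C(2)])
    show "continuous_on UNIV (\<lambda>x. \<phi> x *\<^sub>R grad h x)"
      by (intro continuous_on_scaleR cont)
    show "\<phi> x *\<^sub>R grad h x = 0" if "x \<notin> ?K" for x
      using 0[OF that] by (simp only: scaleR_zero_left)
  qed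
  have "bounded {x. h x * \<phi> x \<noteq> 0}"
    by (rule bounded_subset[OF Cc_one_bounded_support[OF \<phi>]]) auto
  moreover have "Ck_on 1 UNIV (\<lambda>x. h x * \<phi> x)"
    using h C(1) by (rule Ck_on_mult)
  ultimately have "(LINT x|lebesgue. grad (\<lambda>x. h x * \<phi> x) x) = 0"
    by (intro integral_grad_eq_0)
  then have "(LINT x|lebesgue. h x *\<^sub>R grad \<phi> x) = - (LINT x|lebesgue. \<phi> x *\<^sub>R grad h x)"
    using int1 int2 by (simp add: grad_mult[OF h C(1)] eq_neg_iff_add_eq_0)
  moreover have "(\<lambda>x. indicator \<Omega> x *\<^sub>R (h x *\<^sub>R grad \<phi> x)) = (\<lambda>x. h x *\<^sub>R grad \<phi> x)"
    "(\<lambda>x. indicator \<Omega> x *\<^sub>R (\<phi> x *\<^sub>R grad h x)) = (\<lambda>x. \<phi> x *\<^sub>R grad h x)"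
    using Cc_one_outside[OF \<phi>] Cc_one_grad_outside[OF \<phi>] by (auto simp: indicator_def fun_eq_iff)
  ultimately show ?thesis
    using \<open>open \<Omega>\<close> by (simp add: integral_restrict_space)
qed

section \<open>A continuously differentiable positive part\<close>

text \<open>
  For \<open>s > 0\<close> this is \<open>s\<^sup>2/(s + e)\<close>, which differs from \<open>s\<close> by at most \<open>e\<close> and whose derivative
  lies between \<open>0\<close> and \<open>1\<close>. It vanishes at \<open>0\<close> together with its derivative. Composition with
  it therefore turns test functions into nonnegative \<open>C\<^sup>1\<close> test functions without increasing
  gradients.
\<close>

definition smooth_pos :: "real \<Rightarrow> real \<Rightarrow> real" where
  "smooth_pos e s = (max 0 s)\<^sup>2 / (max 0 s + e)"

definition smooth_pos' :: "real \<Rightarrow> real \<Rightarrow> real" where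
  "smooth_pos' e s = 1 - (e / (max 0 s + e))\<^sup>2"

lemma smooth_pos_deriv:
  assumes "e > 0"
  shows "(smooth_pos e has_real_derivative smooth_pos' e s) (at s)"
proof -
  consider "s < 0" | "s = 0" | "s > 0" by linarith
  then show ?thesis
  proof cases
    case 1
    have "\<forall>\<^sub>F t in nhds s. smooth_pos e t = 0"
      using eventually_nhds_in_open[of "{..<0}" s] 1
      by (auto simp: smooth_pos_def elim!: eventually_mono)
    moreover have "smooth_pos' e s = 0"
      using 1 assms by (simp add: smooth_pos'_def)
    ultimately show ?thesis
      by (subst DERIV_cong_ev[OF refl _ refl, of _ "\<lambda>_. 0"]) auto
  next
    case 2
    have "((\<lambda>h. smooth_pos e h / h) \<longlongrightarrow> 0) (at 0)"
    proof (rule Lim_null_comparison)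
      show "\<forall>\<^sub>F h in at 0. norm (smooth_pos e h / h) \<le> \<bar>h\<bar> / e"
      proof (rule always_eventually, intro allI)
        fix h :: real
        show "norm (smooth_pos e h / h) \<le> \<bar>h\<bar> / e"
          using assms by (cases "h > 0") (auto simp: smooth_pos_def power2_eq_square divide_nonpos_pos intro!: frac_le)
      qed
      show "((\<lambda>h. \<bar>h\<bar> / e) \<longlongrightarrow> 0) (at 0)"
        using assms by (auto intro!: tendsto_eq_intros)
    qed
    then show ?thesis
      using 2 assms by (simp add: DERIV_def smooth_pos_def smooth_pos'_def)
  next
    case 3
    have "((\<lambda>t. t\<^sup>2 / (t + e)) has_real_derivative smooth_pos' e s) (at s)"
    proof -
      have "((\<lambda>t. t\<^sup>2 / (t + e)) has_real_derivative (2 * s * (s + e) - s\<^sup>2 * 1) / (s + e)\<^sup>2) (at s)"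
        using 3 assms by (auto intro!: derivative_eq_intros simp: power2_eq_square)
      moreover have "(2 * s * (s + e) - s\<^sup>2 * 1) / (s + e)\<^sup>2 = smooth_pos' e s"
      proof -
        have "s + e \<noteq> 0" using 3 assms by simp
        then have "1 - (e / (s + e))\<^sup>2 = ((s + e)\<^sup>2 - e\<^sup>2) / (s + e)\<^sup>2"
          by (simp add: diff_divide_distrib power_divide)
        then show ?thesis
          using 3 by (simp add: smooth_pos'_def power2_eq_square algebra_simps)
      qed
      ultimately show ?thesis by simp
    qed
    moreover have "\<forall>\<^sub>F t in nhds s. smooth_pos e t = t\<^sup>2 / (t + e)"
      using eventually_nhds_in_open[of "{0<..}" s] 3
      by (auto simp: smooth_pos_def elim!: eventually_mono)
    ultimately show ?thesis
      by (subst DERIV_cong_ev[OF refl _ refl]) auto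
  qed
qed

lemma smooth_pos'_continuous: "e > 0 \<Longrightarrow> continuous_on UNIV (smooth_pos' e)"
  unfolding smooth_pos'_def[abs_def] by (intro continuous_intros) (auto simp: add_nonneg_eq_0_iff)

lemma smooth_pos'_bounds:
  assumes "e > 0"
  shows "0 \<le> smooth_pos' e s" "smooth_pos' e s \<le> 1"
proof -
  have "(e / (max 0 s + e))\<^sup>2 \<le> 1"
    using assms by (intro power_le_one) auto
  then show "0 \<le> smooth_pos' e s" by (simp add: smooth_pos'_def)
  show "smooth_pos' e s \<le> 1" by (simp add: smooth_pos'_def)
qed

lemma smooth_pos_nonneg: "e > 0 \<Longrightarrow> 0 \<le> smooth_pos e s"
  by (simp add: smooth_pos_def)

lemma smooth_pos_0: "smooth_pos e 0 = 0"
  by (simp add: smooth_pos_def)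

lemma smooth_pos_approx:
  assumes "e > 0"
  shows "\<bar>smooth_pos e s - max 0 s\<bar> \<le> e"
proof -
  define m where "m = max 0 s"
  have m: "m \<ge> 0" "m + e > 0" using assms by (auto simp: m_def)
  have "m\<^sup>2 / (m + e) - m = - (m / (m + e) * e)"
    using m(2) by (simp add: field_simps power2_eq_square)
  moreover have "0 \<le> m / (m + e)" "m / (m + e) \<le> 1"
    using m assms by auto
  then have "0 \<le> m / (m + e) * e" "m / (m + e) * e \<le> e"
    using m assms mult_left_le_one_le[of e "m / (m + e)"] by simp_all
  ultimately show ?thesis
    unfolding smooth_pos_def m_def[symmetric] by linarith
qed

lemma smooth_pos_lipschitz:
  assumes "e > 0"
  shows "\<bar>smooth_pos e s - smooth_pos e t\<bar> \<le> \<bar>s - t\<bar>"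
proof -
  have "\<bar>smooth_pos e b - smooth_pos e a\<bar> \<le> \<bar>b - a\<bar>" if ab: "a < b" for a b
  proof -
    obtain z where "smooth_pos e b - smooth_pos e a = (b - a) * smooth_pos' e z"
      using MVT2[OF ab, of "smooth_pos e" "smooth_pos' e"] smooth_pos_deriv[OF assms] by blast
    then show ?thesis
      using smooth_pos'_bounds[OF assms, of z] by (simp add: abs_mult mult_right_le_one_le)
  qed
  from this[of s t] this[of t s] show ?thesis by (cases s t rule: linorder_cases) auto
qed

lemma smooth_pos_tendsto:
  "(\<lambda>n. smooth_pos (inverse (real (Suc n))) s) \<longlonglongrightarrow> max 0 s"
proof -
  have "(\<lambda>n. smooth_pos (inverse (real (Suc n))) s - max 0 s) \<longlonglongrightarrow> 0"
    using smooth_pos_approx[of "inverse (real (Suc _))" s]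
    by (intro Lim_null_comparison[OF _ LIMSEQ_inverse_real_of_nat] always_eventually) auto
  then show ?thesis by (simp add: LIM_zero_iff)
qed

lemma smooth_pos'_tendsto:
  "(\<lambda>n. smooth_pos' (inverse (real (Suc n))) s) \<longlonglongrightarrow> indicator {0<..} s"
proof (cases "s > 0")
  case True
  have "(\<lambda>n. 1 - (inverse (real (Suc n)) / (s + inverse (real (Suc n))))\<^sup>2) \<longlonglongrightarrow> 1 - (0 / (s + 0))\<^sup>2"
    using True by (intro tendsto_intros LIMSEQ_inverse_real_of_nat) auto
  then show ?thesis using True by (simp add: smooth_pos'_def)
next
  case False
  then show ?thesis by (simp add: smooth_pos'_def max_def)
qed

section \<open>Elementary inequalities for powers\<close>

text \<open>
  Either \<open>t\<close> is at most \<open>\<delta> s\<close>, and the first term dominates, or \<open>s\<close> is less than \<open>t/\<delta>\<close>, and the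
  second term does. This is Young's inequality up to the value of the constant.
\<close>

lemma powr_absorb:
  fixes s t \<delta> p :: real
  assumes "\<delta> > 0" "0 \<le> s" "0 \<le> t" "p > 1"
  shows "s powr (p - 1) * t \<le> \<delta> * s powr p + \<delta> powr (1 - p) * t powr p"
proof (cases "t \<le> \<delta> * s")
  case True
  have "s powr (p - 1) * t \<le> s powr (p - 1) * (\<delta> * s)"
    using True by (intro mult_left_mono) auto
  also have "\<dots> = \<delta> * s powr p"
    using assms by (cases "s = 0") (auto simp: powr_diff)
  finally show ?thesis
    using assms by (smt (verit) mult_nonneg_nonneg powr_ge_zero)
next
  case False
  moreover have "0 \<le> \<delta> * s" using assms by simp
  ultimately have t: "s < t / \<delta>" "t > 0"
    using assms(1) by (simp_all add: pos_less_divide_eq mult.commute)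
  have "s powr (p - 1) * t \<le> (t / \<delta>) powr (p - 1) * t"
    using t assms by (intro mult_right_mono powr_mono2) auto
  also have "\<dots> = \<delta> powr (1 - p) * t powr p"
    using t assms by (simp add: powr_divide powr_diff field_simps)
  finally show ?thesis
    using assms by (smt (verit) mult_nonneg_nonneg powr_ge_zero)
qed

text \<open>
  The same dichotomy, now according to whether \<open>t\<close> exceeds \<open>\<delta> s\<^sup>p\<^sup>-\<^sup>1\<close>.
\<close>

lemma powr_absorb_conjugate:
  fixes s t \<delta> p :: real
  assumes "\<delta> > 0" "0 \<le> s" "0 \<le> t" "p > 1"
  shows "s * t \<le> \<delta> * s powr p + \<delta> powr (- (1 / (p - 1))) * t powr (p / (p - 1))"
proof (cases "t \<le> \<delta> * s powr (p - 1)")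
  case True
  have "s * t \<le> s * (\<delta> * s powr (p - 1))"
    using True assms by (intro mult_left_mono) auto
  also have "\<dots> = \<delta> * s powr p"
    using assms by (cases "s = 0") (auto simp: powr_diff)
  finally show ?thesis
    using assms by (smt (verit) mult_nonneg_nonneg powr_ge_zero)
next
  case False
  moreover have "0 \<le> \<delta> * s powr (p - 1)" using assms by simp
  ultimately have "s powr (p - 1) * \<delta> \<le> t" "t > 0"
    by (simp_all only: mult.commute[of _ \<delta>] not_le)
  then have t: "s powr (p - 1) \<le> t / \<delta>" "t > 0"
    using assms(1) by (simp_all add: pos_le_divide_eq)
  have "s = (s powr (p - 1)) powr (1 / (p - 1))"
    using assms by (simp add: powr_powr)
  also have "\<dots> \<le> (t / \<delta>) powr (1 / (p - 1))"
    using t assms by (intro powr_mono2) auto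
  finally have "s * t \<le> (t / \<delta>) powr (1 / (p - 1)) * t"
    using assms by (intro mult_right_mono) auto
  also have "\<dots> = \<delta> powr (- (1 / (p - 1))) * (t powr (1 / (p - 1)) * t powr 1)"
    using t assms by (simp add: powr_divide powr_minus field_simps)
  also have "t powr (1 / (p - 1)) * t powr 1 = t powr (p / (p - 1))"
    unfolding powr_add[symmetric] using assms by (simp add: field_simps)
  finally show ?thesis
    using assms by (smt (verit) mult_nonneg_nonneg powr_ge_zero)
qed

text \<open>
  The sum is at most twice the larger summand.
\<close>

lemma powr_norm_add_le:
  fixes a b :: "'b::real_normed_vector"
  assumes "p > 0"
  shows "norm (a + b) powr p \<le> 2 powr p * (norm a powr p + norm b powr p)"
proof -
  have "norm (a + b) powr p \<le> (2 * max (norm a) (norm b)) powr p"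
    using assms norm_triangle_ineq[of a b] by (intro powr_mono2) auto
  also have "\<dots> = 2 powr p * (max (norm a) (norm b)) powr p"
    by (simp add: powr_mult)
  also have "\<dots> \<le> 2 powr p * (norm a powr p + norm b powr p)"
    by (intro mult_left_mono) (auto simp: max_def)
  finally show ?thesis .
qed

text \<open>
  An inequality of absorption type turns convergence of \<open>Y\<close> into convergence of \<open>X\<close>,
  however fast \<open>C \<delta>\<close> blows up as \<open>\<delta>\<close> tends to \<open>0\<close>. It is applied with the \<open>L\<^sup>1\<close> norm as \<open>X\<close>,
  the \<open>p\<close>-th power of the \<open>L\<^sup>p\<close> norm as \<open>Y\<close> and the measure of the domain as \<open>A\<close>.
\<close>

lemma tendsto_0_if_absorbed:
  fixes X Y :: "nat \<Rightarrow> real"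
  assumes "\<And>n. 0 \<le> X n" "\<And>n \<delta>. \<delta> > 0 \<Longrightarrow> X n \<le> \<delta> * A + C \<delta> * Y n" "Y \<longlonglongrightarrow> 0" "A \<ge> 0"
  shows "X \<longlonglongrightarrow> 0"
proof (rule LIMSEQ_I)
  fix r :: real assume r: "r > 0"
  define \<delta> where "\<delta> = r / (2 * (A + 1))"
  have \<delta>: "\<delta> > 0" "\<delta> * A < r / 2"
    using r assms(4) by (auto simp: \<delta>_def field_simps)
  have "(\<lambda>n. C \<delta> * Y n) \<longlonglongrightarrow> 0"
    using assms(3) tendsto_mult_right_zero by blast
  then obtain N where "\<forall>n\<ge>N. \<bar>C \<delta> * Y n\<bar> < r / 2"
    using r LIMSEQ_D[of "\<lambda>n. C \<delta> * Y n" 0 "r/2"] by (metis diff_zero half_gt_zero real_norm_def)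
  then have "\<forall>n\<ge>N. norm (X n - 0) < r"
    using assms(1) assms(2)[OF \<delta>(1)] \<delta>(2) by (smt (verit) real_norm_def field_sum_of_halves)
  then show "\<exists>N. \<forall>n\<ge>N. norm (X n - 0) < r" by blast
qed

section \<open>The Poincare inequality\<close>

text \<open>
  Taking the positive part extends the power to a \<open>C\<^sup>1\<close> function on the whole line, which can
  then be composed with arbitrary \<open>C\<^sup>1\<close> functions.
\<close>

lemma max_powr_deriv:
  assumes "p > 1"
  shows "((\<lambda>t. (max 0 t) powr p) has_real_derivative p * (max 0 t) powr (p - 1)) (at t)"
proof -
  consider "t < 0" | "t = 0" | "t > 0" by linarith
  then show ?thesis
  proof cases
    case 1
    have "\<forall>\<^sub>F s in nhds t. (max 0 s) powr p = 0"
      using eventually_nhds_in_open[of "{..<0}" t] 1 by (auto elim!: eventually_mono)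
    then show ?thesis
      using 1 by (subst DERIV_cong_ev[OF refl _ refl, of _ "\<lambda>_. 0"]) auto
  next
    case 2
    have "((\<lambda>h. (max 0 h) powr p / h) \<longlongrightarrow> 0) (at 0)"
    proof (rule Lim_null_comparison)
      show "\<forall>\<^sub>F h in at 0. norm ((max 0 h) powr p / h) \<le> \<bar>h\<bar> powr (p - 1)"
        by (rule always_eventually) (auto simp: max_def powr_diff divide_simps)
      have "continuous_on UNIV (\<lambda>h::real. \<bar>h\<bar> powr (p - 1))"
        using assms by (intro continuous_on_powr' continuous_intros) auto
      then have "isCont (\<lambda>h::real. \<bar>h\<bar> powr (p - 1)) 0"
        by (simp add: continuous_on_eq_continuous_at)
      then show "((\<lambda>h. \<bar>h\<bar> powr (p - 1)) \<longlongrightarrow> 0) (at 0)"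
        by (simp add: isCont_def)
    qed
    then show ?thesis
      using 2 by (simp add: DERIV_def)
  next
    case 3
    have "((\<lambda>t. t powr p) has_real_derivative p * t powr (p - 1)) (at t)"
      using 3 by (rule has_real_derivative_powr)
    moreover have "\<forall>\<^sub>F s in nhds t. (max 0 s) powr p = s powr p"
      using eventually_nhds_in_open[of "{0<..}" t] 3 by (auto elim!: eventually_mono)
    ultimately show ?thesis
      using 3 by (subst DERIV_cong_ev[OF refl _ refl, of _ "\<lambda>s. s powr p"]) auto
  qed
qed

lemma max_powr_continuous:
  assumes "p > 0"
  shows "continuous_on UNIV (\<lambda>t::real. c * (max 0 t) powr p)"
  using assms by (intro continuous_on_powr' continuous_intros) auto

lemma Cc_one_integrable_powr:
  assumes "open \<Omega>" "\<phi> \<in> Cc_one \<Omega>" "p > 0"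
  shows "integrable (lebesgue_on \<Omega>) (\<lambda>x. \<bar>\<phi> x\<bar> powr p)"
    and "integrable (lebesgue_on \<Omega>) (\<lambda>x. norm (grad \<phi> x) powr p)"
    and "integrable (lebesgue_on \<Omega>) (\<lambda>x. \<phi> x)"
    and "integrable (lebesgue_on \<Omega>) (\<lambda>x. grad \<phi> x)"
proof -
  define K where "K = closure {x. \<phi> x \<noteq> 0}"
  have K: "bounded K" "Ck_on 1 UNIV \<phi>" and S: "\<Omega> \<in> sets lebesgue"
    using assms by (auto simp: Cc_one_def compact_imp_bounded K_def)
  have cont: "continuous_on UNIV \<phi>" "continuous_on UNIV (grad \<phi>)"
    using K by (simp_all add: Ck_on_1_continuous continuous_on_grad)
  have 0: "\<phi> x = 0" "grad \<phi> x = 0" if "x \<notin> K" for x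
    using that grad_eq_0_outside[of x \<phi>] closure_subset[of "{x. \<phi> x \<noteq> 0}"] by (auto simp only: K_def)
  note I = integrable_continuous_bounded_support(3)[OF _ K(1) _ S]
  show "integrable (lebesgue_on \<Omega>) (\<lambda>x. \<bar>\<phi> x\<bar> powr p)"
    by (rule I, intro continuous_on_powr' continuous_intros cont) (use assms(3) in \<open>auto simp: 0\<close>)
  show "integrable (lebesgue_on \<Omega>) (\<lambda>x. norm (grad \<phi> x) powr p)"
    by (rule I, intro continuous_on_powr' continuous_intros cont) (use assms(3) in \<open>auto simp: 0\<close>)
  show "integrable (lebesgue_on \<Omega>) (\<lambda>x. \<phi> x)" "integrable (lebesgue_on \<Omega>) (\<lambda>x. grad \<phi> x)"
    by (rule I; use cont in \<open>simp add: 0\<close>)+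
qed

text \<open>
  For a basis vector \<open>b\<close>, the derivative of \<open>(x \<bullet> b) \<psi>\<^sup>p\<close> in direction \<open>b\<close> is
  \<open>\<psi>\<^sup>p + (x \<bullet> b) p \<psi>\<^sup>p\<^sup>-\<^sup>1 (\<nabla>\<psi> \<bullet> b)\<close> and has integral zero. On \<open>\<Omega>\<close> the factor \<open>x \<bullet> b\<close> is at most \<open>R\<close>,
  and absorption with \<open>\<delta> = 1/(2 R p)\<close> moves one half of the integral of \<open>\<psi>\<^sup>p\<close> back to the left.
\<close>

lemma Poincare_inequality:
  fixes \<psi> :: "'a::euclidean_space \<Rightarrow> real"
  assumes "open \<Omega>" "\<Omega> \<subseteq> cball 0 R" "R > 0" "p > 1"
    and \<psi>: "\<psi> \<in> Cc_one \<Omega>" "\<And>x. 0 \<le> \<psi> x"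
  shows "(LINT x|lebesgue_on \<Omega>. \<psi> x powr p)
    \<le> (2 * R * p) powr p * (LINT x|lebesgue_on \<Omega>. norm (grad \<psi> x) powr p)"
proof -
  let ?M = "lebesgue_on \<Omega>"
  obtain b :: 'a where b: "b \<in> Basis" using nonempty_Basis by blast
  define \<Phi> where "\<Phi> x = (max 0 (\<psi> x)) powr p" for x
  have C: "Ck_on 1 UNIV \<psi>" using \<psi> by (simp add: Cc_one_def)
  have \<Phi>: "\<Phi> \<in> Cc_one \<Omega>" and
    gr: "grad \<Phi> x = (p * (max 0 (\<psi> x)) powr (p - 1)) *\<^sub>R grad \<psi> x" for x
    unfolding \<Phi>_def[abs_def] using \<open>p > 1\<close>
    by (auto intro!: Cc_one_compose[OF \<psi>(1) max_powr_deriv] max_powr_continuous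
        C1_compose_real(2)[OF C max_powr_deriv])
  have h: "((\<lambda>x. x \<bullet> b) has_derivative (\<lambda>h. h \<bullet> b)) (at x)" for x
    by (auto intro!: derivative_eq_intros)
  have int\<Phi>: "integrable ?M \<Phi>" "integrable ?M (grad \<Phi>)"
    using Cc_one_integrable_powr(3,4)[OF \<open>open \<Omega>\<close> \<Phi>, of 1] by auto
  have int: "integrable ?M (\<lambda>x. \<psi> x powr p)" "integrable ?M (\<lambda>x. norm (grad \<psi> x) powr p)"
    using Cc_one_integrable_powr(1,2)[OF \<open>open \<Omega>\<close> \<psi>(1), of p] \<psi>(2) \<open>p > 1\<close> by auto
  have intx: "integrable ?M (\<lambda>x. (x \<bullet> b) *\<^sub>R grad \<Phi> x)"
  proof (rule integrable_continuous_bounded_support(3))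
    show "continuous_on UNIV (\<lambda>x. (x \<bullet> b) *\<^sub>R grad \<Phi> x)"
      by (intro continuous_intros continuous_on_grad Cc_one_C1[OF \<Phi>])
    show "bounded \<Omega>" using assms(2) bounded_cball bounded_subset by blast
    show "x \<notin> \<Omega> \<Longrightarrow> (x \<bullet> b) *\<^sub>R grad \<Phi> x = 0" for x
      using Cc_one_grad_outside[OF \<Phi>] by simp
  qed (use \<open>open \<Omega>\<close> in auto)
  have "(LINT x|?M. (x \<bullet> b) *\<^sub>R grad \<Phi> x) = - (LINT x|?M. \<Phi> x *\<^sub>R grad (\<lambda>x. x \<bullet> b) x)"
    by (rule integral_by_parts[OF \<open>open \<Omega>\<close> \<Phi>]) (rule Ck_on_1I[OF h], simp)
  also have "\<dots> = - (LINT x|?M. \<Phi> x) *\<^sub>R b"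
    using grad_eq[OF h] int\<Phi> by simp
  finally have "(LINT x|?M. (x \<bullet> b) *\<^sub>R grad \<Phi> x) \<bullet> b = - (LINT x|?M. \<Phi> x)"
    using b by simp
  moreover define k where "k x = - (((x \<bullet> b) *\<^sub>R grad \<Phi> x) \<bullet> b)" for x
  have intk: "integrable ?M k" and "(LINT x|?M. k x) = - ((LINT x|?M. (x \<bullet> b) *\<^sub>R grad \<Phi> x) \<bullet> b)"
    unfolding k_def[abs_def] using intx integrable_inner_left[of b ?M, OF intx] integral_inner_left[of b ?M, OF intx]
    by (simp_all del: inner_scaleR_left)
  ultimately have "(LINT x|?M. \<Phi> x) = (LINT x|?M. k x)"
    by simp
  also have "\<dots> \<le> (LINT x|?M. 1/2 * \<psi> x powr p + (2 * R * p) powr p / 2 * norm (grad \<psi> x) powr p)"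
  proof (rule integral_mono[OF intk])
    show "integrable ?M (\<lambda>x. 1/2 * \<psi> x powr p + (2 * R * p) powr p / 2 * norm (grad \<psi> x) powr p)"
      using int by auto
    fix x assume "x \<in> space ?M"
    then have x: "norm x \<le> R" using assms(2) by auto
    define s t \<delta> where "s = \<psi> x" and "t = norm (grad \<psi> x)" and "\<delta> = 1 / (2 * R * p)"
    have \<delta>: "\<delta> > 0" using assms by (simp add: \<delta>_def)
    have "k x \<le> \<bar>x \<bullet> b\<bar> * (p * s powr (p - 1)) * \<bar>grad \<psi> x \<bullet> b\<bar>"
    proof -
      have "k x \<le> \<bar>(x \<bullet> b) * ((p * s powr (p - 1)) * (grad \<psi> x \<bullet> b))\<bar>"
        using \<psi>(2)[of x] unfolding k_def gr s_def by (simp add: max_absorb2)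
      also have "\<dots> = \<bar>x \<bullet> b\<bar> * (p * s powr (p - 1)) * \<bar>grad \<psi> x \<bullet> b\<bar>"
        using \<open>p > 1\<close> by (simp add: abs_mult)
      finally show ?thesis .
    qed
    also have "\<dots> \<le> R * (p * s powr (p - 1)) * t"
      using x Basis_le_norm[OF b, of x] Basis_le_norm[OF b, of "grad \<psi> x"] assms
      by (intro mult_mono) (auto simp: t_def)
    also have "\<dots> = R * p * (s powr (p - 1) * t)" by simp
    also have "\<dots> \<le> R * p * (\<delta> * s powr p + \<delta> powr (1 - p) * t powr p)"
      using assms \<delta> \<psi>(2) by (intro mult_left_mono powr_absorb) (auto simp: s_def t_def)
    also have "\<dots> = (R * p * \<delta>) * s powr p + (R * p * \<delta> powr (1 - p)) * t powr p"
      by (simp add: algebra_simps)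
    also have "R * p * \<delta> = 1/2" using assms by (simp add: \<delta>_def)
    also have "R * p * \<delta> powr (1 - p) = (2 * R * p) powr p / 2"
    proof -
      have "\<delta> powr (1 - p) = (2 * R * p) powr (p - 1)"
        using assms by (simp add: \<delta>_def powr_divide powr_diff)
      also have "\<dots> = (2 * R * p) powr p / (2 * R * p)"
        using assms by (simp add: powr_diff)
      finally show ?thesis using assms by simp
    qed
    finally show "k x \<le> 1/2 * \<psi> x powr p + (2 * R * p) powr p / 2 * norm (grad \<psi> x) powr p"
      by (simp add: s_def t_def)
  qed
  also have "\<dots> = 1/2 * (LINT x|?M. \<psi> x powr p)
      + (2 * R * p) powr p / 2 * (LINT x|?M. norm (grad \<psi> x) powr p)"
    using int by simp
  finally show ?thesis
    using \<psi>(2) by (simp add: \<Phi>_def max_def)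
qed

section \<open>Integrability on bounded open sets\<close>

lemma in_L1_loc_integrable_mult:
  fixes w :: "'a::euclidean_space \<Rightarrow> 'b::euclidean_space"
  assumes "open \<Omega>" "in_L1_loc \<Omega> w" "\<phi> \<in> Cc_one \<Omega>"
  shows "integrable (lebesgue_on \<Omega>) (\<lambda>x. \<phi> x *\<^sub>R w x)"
proof -
  define K where "K = closure {x. \<phi> x \<noteq> 0}"
  have K: "compact K" "K \<subseteq> \<Omega>" "Ck_on 1 UNIV \<phi>" and S: "\<Omega> \<in> sets lebesgue"
    using assms by (auto simp: Cc_one_def K_def)
  have KL: "K \<in> sets lebesgue"
    using K(1) lmeasurable_compact fmeasurableD by blast
  have 0: "\<phi> x = 0" if "x \<notin> K" for x
    using that closure_subset[of "{x. \<phi> x \<noteq> 0}"] by (auto simp only: K_def)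
  obtain M where M: "M > 0" "\<And>x. \<bar>\<phi> x\<bar> \<le> M"
    using Cc_one_bounded[OF assms(3)] by blast
  have "integrable (lebesgue_on K) w"
    using assms(2) K by (auto simp: in_L1_loc_def)
  then have w: "integrable lebesgue (\<lambda>x. indicator K x *\<^sub>R w x)"
    using KL by (subst (asm) integrable_restrict_space) auto
  have \<phi>: "\<phi> \<in> borel_measurable lebesgue"
    using Ck_on_1_continuous[OF K(3)] by (auto intro!: measurable_completion borel_measurable_continuous_onI)
  have "integrable lebesgue (\<lambda>x. \<phi> x *\<^sub>R (indicator K x *\<^sub>R w x))"
  proof (rule Bochner_Integration.integrable_bound[OF integrable_scaleR_right[OF w, of M]])
    show "(\<lambda>x. \<phi> x *\<^sub>R (indicator K x *\<^sub>R w x)) \<in> borel_measurable lebesgue"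
      using \<phi> borel_measurable_integrable[OF w] by (rule borel_measurable_scaleR)
    show "AE x in lebesgue. norm (\<phi> x *\<^sub>R (indicator K x *\<^sub>R w x)) \<le> norm (M *\<^sub>R (indicator K x *\<^sub>R w x))"
    proof (rule AE_I2)
      fix x
      have "\<bar>\<phi> x\<bar> * norm (indicat_real K x *\<^sub>R w x) \<le> M * norm (indicat_real K x *\<^sub>R w x)"
        by (intro mult_right_mono M(2)) simp
      then show "norm (\<phi> x *\<^sub>R (indicator K x *\<^sub>R w x)) \<le> norm (M *\<^sub>R (indicator K x *\<^sub>R w x))"
        using M(1) by (simp only: norm_scaleR[of "\<phi> x"] norm_scaleR[of M] abs_of_pos)
    qed
  qed
  also have "(\<lambda>x. \<phi> x *\<^sub>R (indicator K x *\<^sub>R w x)) = (\<lambda>x. indicator \<Omega> x *\<^sub>R (\<phi> x *\<^sub>R w x))"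
    using 0 K(2) by (auto simp: indicator_def fun_eq_iff)
  finally show ?thesis
    using S by (subst integrable_restrict_space) auto
qed

lemma integrable_imp_in_L1_loc:
  fixes w :: "'a::euclidean_space \<Rightarrow> 'b::euclidean_space"
  assumes "open \<Omega>" "integrable (lebesgue_on \<Omega>) w"
  shows "in_L1_loc \<Omega> w"
  unfolding in_L1_loc_def
proof (intro conjI allI impI)
  show "w \<in> borel_measurable (lebesgue_on \<Omega>)"
    using assms(2) by (rule borel_measurable_integrable)
  fix K assume K: "compact K \<and> K \<subseteq> \<Omega>"
  then have KL: "K \<in> sets lebesgue"
    using lmeasurable_compact fmeasurableD by blast
  have "integrable lebesgue (\<lambda>x. indicator \<Omega> x *\<^sub>R w x)"
    using assms by (subst (asm) integrable_restrict_space) auto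
  then have "integrable lebesgue (\<lambda>x. indicator K x *\<^sub>R (indicator \<Omega> x *\<^sub>R w x))"
    using KL by (rule integrable_mult_indicator[rotated])
  also have "(\<lambda>x. indicator K x *\<^sub>R (indicator \<Omega> x *\<^sub>R w x)) = (\<lambda>x. indicator K x *\<^sub>R w x)"
    using K by (auto simp: indicator_def fun_eq_iff)
  finally show "integrable (lebesgue_on K) w"
    using KL by (subst integrable_restrict_space) auto
qed

lemma bounded_open_finite_measure:
  "open \<Omega> \<Longrightarrow> bounded \<Omega> \<Longrightarrow> finite_measure (lebesgue_on (\<Omega>::'a::euclidean_space set))"
  by (intro finite_measure_lebesgue_on lmeasurable_open)

lemma in_Lp_diff:
  assumes "in_Lp p \<Omega> f" "in_Lp p \<Omega> g" "p > 0"
  shows "in_Lp p \<Omega> (\<lambda>x. f x - g x)"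
proof -
  have [measurable]: "f \<in> borel_measurable (lebesgue_on \<Omega>)" "g \<in> borel_measurable (lebesgue_on \<Omega>)"
    using assms by (auto simp: in_Lp_def)
  have "integrable (lebesgue_on \<Omega>) (\<lambda>x. 2 powr p * (norm (f x) powr p + norm (g x) powr p))"
    using assms by (auto simp: in_Lp_def)
  then have "integrable (lebesgue_on \<Omega>) (\<lambda>x. norm (f x - g x) powr p)"
    using powr_norm_add_le[OF \<open>p > 0\<close>, of "f _" "- g _"]
    by (elim Bochner_Integration.integrable_bound) auto
  then show ?thesis by (auto simp: in_Lp_def)
qed

lemma in_Lp_integrable:
  assumes "open \<Omega>" "bounded \<Omega>" "in_Lp p \<Omega> f" "p \<ge> 1"
  shows "integrable (lebesgue_on \<Omega>) f"
proof -
  interpret finite_measure "lebesgue_on \<Omega>"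
    using assms by (intro bounded_open_finite_measure)
  have "norm (f x) \<le> 1 + norm (f x) powr p" for x
    using powr_mono[OF assms(4), of "norm (f x)"] by (cases "norm (f x) \<le> 1") (auto intro: add_increasing2)
  moreover have "integrable (lebesgue_on \<Omega>) (\<lambda>x. 1 + norm (f x) powr p)"
    using assms by (auto simp: in_Lp_def)
  ultimately show ?thesis
    using assms(3) by (elim Bochner_Integration.integrable_bound) (auto simp: in_Lp_def)
qed

lemma Lp_norm_tendsto_0D:
  assumes "(\<lambda>n. Lp_norm p \<Omega> (w n)) \<longlonglongrightarrow> 0" "p > 0"
  shows "(\<lambda>n. LINT x|lebesgue_on \<Omega>. norm (w n x) powr p) \<longlonglongrightarrow> 0"
proof -
  have "(\<lambda>n. Lp_norm p \<Omega> (w n) powr p) \<longlonglongrightarrow> 0"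
    by (rule tendsto_zero_powrI[OF assms(1) tendsto_const]) (auto simp: Lp_norm_def assms(2))
  moreover have "Lp_norm p \<Omega> (w n) powr p = (LINT x|lebesgue_on \<Omega>. norm (w n x) powr p)" for n
  proof -
    have "0 \<le> (LINT x|lebesgue_on \<Omega>. norm (w n x) powr p)"
      by (rule Bochner_Integration.integral_nonneg) auto
    then show ?thesis using assms(2) by (simp add: Lp_norm_def powr_powr)
  qed
  ultimately show ?thesis by simp
qed

text \<open>
  On a set of finite measure, \<open>|w| \<le> \<delta> + \<delta>\<^sup>1\<^sup>-\<^sup>p |w|\<^sup>p\<close> for every \<open>\<delta> > 0\<close>.
\<close>

lemma tendsto_L1_if_tendsto_Lp:
  assumes "open \<Omega>" "bounded \<Omega>" "p > 1" and w: "\<And>n. in_Lp p \<Omega> (w n)"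
    and lim: "(\<lambda>n. LINT x|lebesgue_on \<Omega>. norm (w n x) powr p) \<longlonglongrightarrow> 0"
  shows "(\<lambda>n. LINT x|lebesgue_on \<Omega>. norm (w n x)) \<longlonglongrightarrow> 0"
proof -
  interpret finite_measure "lebesgue_on \<Omega>"
    using assms by (intro bounded_open_finite_measure)
  show ?thesis
  proof (rule tendsto_0_if_absorbed[OF _ _ lim])
    fix n and \<delta> :: real assume \<delta>: "\<delta> > 0"
    have int: "integrable (lebesgue_on \<Omega>) (\<lambda>x. norm (w n x) powr p)"
      using w[of n] by (simp add: in_Lp_def)
    have "(LINT x|lebesgue_on \<Omega>. norm (w n x))
        \<le> (LINT x|lebesgue_on \<Omega>. \<delta> + \<delta> powr (1 - p) * norm (w n x) powr p)"
      using in_Lp_integrable[OF assms(1,2) w[of n]] \<open>p > 1\<close> int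
        powr_absorb[OF \<delta>, of 1 "norm (w n _)" p]
      by (intro integral_mono) auto
    also have "\<dots> = \<delta> * measure (lebesgue_on \<Omega>) (space (lebesgue_on \<Omega>))
        + \<delta> powr (1 - p) * (LINT x|lebesgue_on \<Omega>. norm (w n x) powr p)"
      using int by simp
    finally show "(LINT x|lebesgue_on \<Omega>. norm (w n x))
        \<le> \<delta> * measure (lebesgue_on \<Omega>) (space (lebesgue_on \<Omega>))
        + \<delta> powr (1 - p) * (LINT x|lebesgue_on \<Omega>. norm (w n x) powr p)" .
  qed auto
qed

lemma integral_tendsto_if_dominated_difference:
  fixes A :: "nat \<Rightarrow> 'a \<Rightarrow> 'b::{banach, second_countable_topology}"
  assumes "\<And>n. integrable M (A n)" "integrable M B" "\<And>n. integrable M (d n)"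
    and le: "\<And>n x. norm (A n x - B x) \<le> c * d n x"
    and lim: "(\<lambda>n. LINT x|M. d n x) \<longlonglongrightarrow> 0"
  shows "(\<lambda>n. LINT x|M. A n x) \<longlonglongrightarrow> (LINT x|M. B x)"
proof (rule LIM_zero_cancel, rule Lim_null_comparison)
  show "\<forall>\<^sub>F n in sequentially. norm ((LINT x|M. A n x) - (LINT x|M. B x)) \<le> c * (LINT x|M. d n x)"
  proof (rule always_eventually, intro allI)
    fix n
    have "norm ((LINT x|M. A n x) - (LINT x|M. B x)) = norm (LINT x|M. A n x - B x)"
      using assms by simp
    also have "\<dots> \<le> (LINT x|M. norm (A n x - B x))"
      by (rule integral_norm_bound)
    also have "\<dots> \<le> (LINT x|M. c * d n x)"
      using assms by (intro integral_mono) auto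
    finally show "norm ((LINT x|M. A n x) - (LINT x|M. B x)) \<le> c * (LINT x|M. d n x)"
      using assms by simp
  qed
  show "(\<lambda>n. c * (LINT x|M. d n x)) \<longlonglongrightarrow> 0"
    using tendsto_mult_right_zero[OF lim] .
qed

section \<open>Truncation in Sobolev spaces\<close>

text \<open>
  The approximating test functions in the definition of the Sobolev space, thinned out so that
  they also converge almost everywhere. Convergence in \<open>L\<^sup>1\<close> is what the chain rule below uses, and
  convergence of the gradients in \<open>L\<^sup>p\<close> enters the energy estimate.
\<close>

lemma in_W1_0_approximation:
  assumes "open \<Omega>" "bounded \<Omega>" "p > 1" "in_W1_0 p \<Omega> u"
  obtains g \<phi> where "has_weak_gradient \<Omega> u g" "in_Lp p \<Omega> u" "in_Lp p \<Omega> g"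
    "\<And>n::nat. \<phi> n \<in> Cc_one \<Omega>"
    "(\<lambda>n. LINT x|lebesgue_on \<Omega>. \<bar>\<phi> n x - u x\<bar>) \<longlonglongrightarrow> 0"
    "(\<lambda>n. LINT x|lebesgue_on \<Omega>. norm (grad (\<phi> n) x - g x)) \<longlonglongrightarrow> 0"
    "(\<lambda>n. LINT x|lebesgue_on \<Omega>. norm (grad (\<phi> n) x - g x) powr p) \<longlonglongrightarrow> 0"
    "AE x in lebesgue_on \<Omega>. (\<lambda>n. \<phi> n x) \<longlonglongrightarrow> u x"
proof -
  let ?M = "lebesgue_on \<Omega>"
  obtain g \<phi> where g: "has_weak_gradient \<Omega> u g" "in_Lp p \<Omega> g" and u: "in_Lp p \<Omega> u"
    and \<phi>: "\<And>n. \<phi> n \<in> Cc_infty \<Omega>"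
    and lim: "(\<lambda>n::nat. Lp_norm p \<Omega> (\<lambda>x. \<phi> n x - u x)) \<longlonglongrightarrow> 0"
      "(\<lambda>n. Lp_norm p \<Omega> (\<lambda>x. grad (\<phi> n) x - g x)) \<longlonglongrightarrow> 0"
    using assms(4) unfolding in_W1_0_def by blast
  have \<phi>1: "\<phi> n \<in> Cc_one \<Omega>" for n
    using \<phi> Cc_infty_imp_one by blast
  have Lp: "in_Lp p \<Omega> (\<lambda>x. \<phi> n x - u x)" "in_Lp p \<Omega> (\<lambda>x. grad (\<phi> n) x - g x)" for n
  proof -
    have "in_Lp p \<Omega> (\<phi> n)" "in_Lp p \<Omega> (grad (\<phi> n))"
      using Cc_one_integrable_powr[OF \<open>open \<Omega>\<close> \<phi>1[of n], of p] \<open>p > 1\<close>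
      by (auto simp: in_Lp_def)
    then show "in_Lp p \<Omega> (\<lambda>x. \<phi> n x - u x)" "in_Lp p \<Omega> (\<lambda>x. grad (\<phi> n) x - g x)"
      using u g(2) \<open>p > 1\<close> by (auto intro!: in_Lp_diff)
  qed
  have p0: "p > 0" using assms by simp
  note limp = Lp_norm_tendsto_0D[OF lim(1) p0] Lp_norm_tendsto_0D[OF lim(2) p0]
  note lim1 = tendsto_L1_if_tendsto_Lp[OF assms(1-3) Lp(1) limp(1)]
    tendsto_L1_if_tendsto_Lp[OF assms(1-3) Lp(2) limp(2)]
  have "integrable ?M (\<lambda>x. \<phi> n x - u x)" for n
    using in_Lp_integrable[OF assms(1,2) Lp(1)] \<open>p > 1\<close> by simp
  then obtain r where r: "strict_mono r" "AE x in ?M. (\<lambda>n. \<phi> (r n) x - u x) \<longlonglongrightarrow> 0"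
    using tendsto_L1_AE_subseq[of ?M "\<lambda>n x. \<phi> n x - u x"] lim1(1) by auto
  show ?thesis
  proof (rule that[of g "\<lambda>n. \<phi> (r n)"])
    show "AE x in ?M. (\<lambda>n. \<phi> (r n) x) \<longlonglongrightarrow> u x"
      using r(2) by (simp add: LIM_zero_iff)
    show "(\<lambda>n. LINT x|?M. \<bar>\<phi> (r n) x - u x\<bar>) \<longlonglongrightarrow> 0"
      using LIMSEQ_subseq_LIMSEQ[OF lim1(1) r(1)] by (simp add: o_def)
    show "(\<lambda>n. LINT x|?M. norm (grad (\<phi> (r n)) x - g x)) \<longlonglongrightarrow> 0"
      using LIMSEQ_subseq_LIMSEQ[OF lim1(2) r(1)] by (simp add: o_def)
    show "(\<lambda>n. LINT x|?M. norm (grad (\<phi> (r n)) x - g x) powr p) \<longlonglongrightarrow> 0"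
      using LIMSEQ_subseq_LIMSEQ[OF limp(2) r(1)] by (simp add: o_def)
  qed (use g u \<phi>1 in auto)
qed

text \<open>
  The chain rule for the \<open>C\<^sup>1\<close> function \<open>smooth_pos e (\<cdot> - k)\<close>. It holds for the approximations
  \<open>\<phi> n\<close> by integration by parts. In the limit, the Lipschitz bound takes care of the left-hand
  side; on the right, the gradients converge in \<open>L\<^sup>1\<close> and the coefficients boundedly
  almost everywhere.
\<close>

lemma weak_gradient_smooth_pos:
  fixes u :: "'a::euclidean_space \<Rightarrow> real"
  assumes "open \<Omega>" "bounded \<Omega>" and e: "e > 0"
    and u: "integrable (lebesgue_on \<Omega>) u" and g: "integrable (lebesgue_on \<Omega>) g"
    and \<phi>: "\<And>n::nat. \<phi> n \<in> Cc_one \<Omega>"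
    and lim: "(\<lambda>n. LINT x|lebesgue_on \<Omega>. \<bar>\<phi> n x - u x\<bar>) \<longlonglongrightarrow> 0"
      "(\<lambda>n. LINT x|lebesgue_on \<Omega>. norm (grad (\<phi> n) x - g x)) \<longlonglongrightarrow> 0"
      "AE x in lebesgue_on \<Omega>. (\<lambda>n. \<phi> n x) \<longlonglongrightarrow> u x"
    and \<eta>: "\<eta> \<in> Cc_one \<Omega>"
  shows "(LINT x|lebesgue_on \<Omega>. smooth_pos e (u x - k) *\<^sub>R grad \<eta> x)
    = - (LINT x|lebesgue_on \<Omega>. (\<eta> x * smooth_pos' e (u x - k)) *\<^sub>R g x)"
proof -
  let ?M = "lebesgue_on \<Omega>"
  interpret finite_measure ?M
    using assms(1,2) by (rule bounded_open_finite_measure)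
  have cont: "continuous_on UNIV (smooth_pos e)"
    using smooth_pos_deriv[OF e] by (meson DERIV_isCont continuous_at_imp_continuous_on)
  have [measurable]: "smooth_pos e \<in> borel_measurable borel" "smooth_pos' e \<in> borel_measurable borel"
    using cont smooth_pos'_continuous[OF e] by (auto intro: borel_measurable_continuous_onI)
  have int\<phi>: "integrable ?M (\<phi> n)" "integrable ?M (grad (\<phi> n))" for n
    using Cc_one_integrable_powr(3,4)[OF assms(1) \<phi>, of 1] by auto
  have int\<eta>: "integrable ?M \<eta>" "integrable ?M (grad \<eta>)"
    using Cc_one_integrable_powr(3,4)[OF assms(1) \<eta>, of 1] by auto
  have [measurable]: "\<phi> n \<in> borel_measurable ?M" "grad (\<phi> n) \<in> borel_measurable ?M"
    "\<eta> \<in> borel_measurable ?M" "grad \<eta> \<in> borel_measurable ?M"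
    "u \<in> borel_measurable ?M" "g \<in> borel_measurable ?M" for n
    using int\<phi> int\<eta> u g by auto
  obtain B where B: "\<And>x. \<bar>\<eta> x\<bar> \<le> B" "\<And>x. norm (grad \<eta> x) \<le> B" and B0: "B > 0"
    using Cc_one_bounded[OF \<eta>] by blast
  have le: "\<bar>smooth_pos e s\<bar> \<le> \<bar>s\<bar>" for s
    using smooth_pos_lipschitz[OF e, of s 0] by (simp add: smooth_pos_0)
  have le': "\<bar>\<eta> x * smooth_pos' e s\<bar> \<le> B" for x s
    using smooth_pos'_bounds[OF e, of s] B(1)[of x] mult_mono[of "\<bar>\<eta> x\<bar>" B "smooth_pos' e s" 1]
    by (simp add: abs_mult)
  have int_l: "integrable ?M (\<lambda>x. smooth_pos e (w x - k) *\<^sub>R grad \<eta> x)"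
    if w: "integrable ?M w" for w
  proof (rule Bochner_Integration.integrable_bound)
    have [measurable]: "w \<in> borel_measurable ?M" using w by auto
    show "integrable ?M (\<lambda>x. \<bar>w x - k\<bar> * B)"
      using w by auto
    show "(\<lambda>x. smooth_pos e (w x - k) *\<^sub>R grad \<eta> x) \<in> borel_measurable ?M"
      by measurable
    show "AE x in ?M. norm (smooth_pos e (w x - k) *\<^sub>R grad \<eta> x) \<le> norm (\<bar>w x - k\<bar> * B)"
      using le B B0 by (intro AE_I2) (auto simp: abs_mult intro!: mult_mono)
  qed
  have int_r: "integrable ?M (\<lambda>x. (\<eta> x * smooth_pos' e (w x - k)) *\<^sub>R q x)"
    if [measurable]: "w \<in> borel_measurable ?M" and q: "integrable ?M q" for w and q :: "'a \<Rightarrow> 'a"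
  proof (rule Bochner_Integration.integrable_bound)
    have [measurable]: "q \<in> borel_measurable ?M" using q by auto
    show "integrable ?M (\<lambda>x. B *\<^sub>R q x)"
      using q by auto
    show "(\<lambda>x. (\<eta> x * smooth_pos' e (w x - k)) *\<^sub>R q x) \<in> borel_measurable ?M"
      by measurable
    show "AE x in ?M. norm ((\<eta> x * smooth_pos' e (w x - k)) *\<^sub>R q x) \<le> norm (B *\<^sub>R q x)"
      using le' B0 by (intro AE_I2) (auto intro!: mult_right_mono)
  qed
  \<comment> \<open>Splitting off the difference of gradients leaves a fixed field with varying bounded coefficients.\<close>
  have eq: "(LINT x|?M. smooth_pos e (\<phi> n x - k) *\<^sub>R grad \<eta> x)
    = - (LINT x|?M. (\<eta> x * smooth_pos' e (\<phi> n x - k)) *\<^sub>R (grad (\<phi> n) x - g x))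
      - (LINT x|?M. (\<eta> x * smooth_pos' e (\<phi> n x - k)) *\<^sub>R g x)" for n
  proof -
    have d: "((\<lambda>t. smooth_pos e (t - k)) has_real_derivative smooth_pos' e (t - k)) (at t)" for t
      using DERIV_shift[of "smooth_pos e" "smooth_pos' e (t - k)" t "- k"] smooth_pos_deriv[OF e] by simp
    have d': "continuous_on UNIV (\<lambda>t. smooth_pos' e (t - k))"
      by (rule continuous_on_compose2[OF smooth_pos'_continuous[OF e]]) (auto intro: continuous_intros)
    note C = C1_compose_real[OF Cc_one_C1[OF \<phi>] d d', of n]
    have "(LINT x|?M. smooth_pos e (\<phi> n x - k) *\<^sub>R grad \<eta> x)
      = - (LINT x|?M. \<eta> x *\<^sub>R (smooth_pos' e (\<phi> n x - k) *\<^sub>R grad (\<phi> n) x))"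
      using integral_by_parts[OF assms(1) \<eta> C(1)] unfolding C(2) .
    also have "(\<lambda>x. \<eta> x *\<^sub>R (smooth_pos' e (\<phi> n x - k) *\<^sub>R grad (\<phi> n) x))
      = (\<lambda>x. (\<eta> x * smooth_pos' e (\<phi> n x - k)) *\<^sub>R (grad (\<phi> n) x - g x)
        + (\<eta> x * smooth_pos' e (\<phi> n x - k)) *\<^sub>R g x)"
      by (simp add: scaleR_diff_right)
    finally show ?thesis
      using int_r[of "\<phi> n" "\<lambda>x. grad (\<phi> n) x - g x"] int_r[of "\<phi> n" g] int\<phi> g by simp
  qed
  have lhs: "(\<lambda>n. LINT x|?M. smooth_pos e (\<phi> n x - k) *\<^sub>R grad \<eta> x)
      \<longlonglongrightarrow> (LINT x|?M. smooth_pos e (u x - k) *\<^sub>R grad \<eta> x)"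
  proof (rule integral_tendsto_if_dominated_difference[OF _ _ _ _ lim(1), where c = B])
    fix n x
    have "norm (smooth_pos e (\<phi> n x - k) *\<^sub>R grad \<eta> x - smooth_pos e (u x - k) *\<^sub>R grad \<eta> x)
        = \<bar>smooth_pos e (\<phi> n x - k) - smooth_pos e (u x - k)\<bar> * norm (grad \<eta> x)"
      by (simp flip: scaleR_diff_left)
    also have "\<dots> \<le> \<bar>\<phi> n x - u x\<bar> * B"
      using smooth_pos_lipschitz[OF e, of "\<phi> n x - k" "u x - k"] B(2)[of x] by (intro mult_mono) auto
    finally show "norm (smooth_pos e (\<phi> n x - k) *\<^sub>R grad \<eta> x - smooth_pos e (u x - k) *\<^sub>R grad \<eta> x)
        \<le> B * \<bar>\<phi> n x - u x\<bar>" by (simp add: mult.commute)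
  qed (use int_l int\<phi> u in auto)
  have "(\<lambda>n. LINT x|?M. (\<eta> x * smooth_pos' e (\<phi> n x - k)) *\<^sub>R (grad (\<phi> n) x - g x))
      \<longlonglongrightarrow> (LINT x|?M. 0)"
  proof (rule integral_tendsto_if_dominated_difference[OF _ _ _ _ lim(2), where c = B])
    show "norm ((\<eta> x * smooth_pos' e (\<phi> n x - k)) *\<^sub>R (grad (\<phi> n) x - g x) - 0)
        \<le> B * norm (grad (\<phi> n) x - g x)" for n x
      using mult_right_mono[OF le' norm_ge_zero] by simp
  qed (use int_r int\<phi> g in auto)
  moreover have "(\<lambda>n. LINT x|?M. (\<eta> x * smooth_pos' e (\<phi> n x - k)) *\<^sub>R g x)
      \<longlonglongrightarrow> (LINT x|?M. (\<eta> x * smooth_pos' e (u x - k)) *\<^sub>R g x)"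
  proof (rule integral_dominated_convergence[where w = "\<lambda>x. B * norm (g x)"])
    have "isCont (smooth_pos' e) s" for s
      using smooth_pos'_continuous[OF e] by (simp add: continuous_on_eq_continuous_at)
    then show "AE x in ?M. (\<lambda>n. (\<eta> x * smooth_pos' e (\<phi> n x - k)) *\<^sub>R g x)
        \<longlonglongrightarrow> (\<eta> x * smooth_pos' e (u x - k)) *\<^sub>R g x"
      using lim(3)
      by (auto elim!: eventually_mono intro!: tendsto_intros isCont_tendsto_compose[where g = "smooth_pos' e"])
    show "AE x in ?M. norm ((\<eta> x * smooth_pos' e (\<phi> n x - k)) *\<^sub>R g x) \<le> B * norm (g x)" for n
      using mult_right_mono[OF le' norm_ge_zero] by (intro AE_I2) simp
  qed (use g in auto)
  ultimately have "(\<lambda>n. LINT x|?M. smooth_pos e (\<phi> n x - k) *\<^sub>R grad \<eta> x)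
      \<longlonglongrightarrow> - (LINT x|?M. 0) - (LINT x|?M. (\<eta> x * smooth_pos' e (u x - k)) *\<^sub>R g x)"
    unfolding eq by (intro tendsto_intros)
  then show ?thesis
    using LIMSEQ_unique[OF lhs] by simp
qed

text \<open>
  Letting \<open>e\<close> tend to \<open>0\<close>, the derivatives converge to the indicator function of \<open>{k<..}\<close> with
  value \<open>0\<close> at \<open>k\<close> itself. This limit must be taken after the one in \<open>n\<close>: where \<open>u = k\<close>,
  the coefficients evaluated at \<open>\<phi> n\<close> could oscillate.
\<close>

lemma weak_gradient_pos_part:
  fixes u :: "'a::euclidean_space \<Rightarrow> real"
  assumes "open \<Omega>" "bounded \<Omega>"
    and u: "integrable (lebesgue_on \<Omega>) u" and g: "integrable (lebesgue_on \<Omega>) g"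
    and \<phi>: "\<And>n::nat. \<phi> n \<in> Cc_one \<Omega>"
    and lim: "(\<lambda>n. LINT x|lebesgue_on \<Omega>. \<bar>\<phi> n x - u x\<bar>) \<longlonglongrightarrow> 0"
      "(\<lambda>n. LINT x|lebesgue_on \<Omega>. norm (grad (\<phi> n) x - g x)) \<longlonglongrightarrow> 0"
      "AE x in lebesgue_on \<Omega>. (\<lambda>n. \<phi> n x) \<longlonglongrightarrow> u x"
    and \<eta>: "\<eta> \<in> Cc_one \<Omega>"
  shows "(LINT x|lebesgue_on \<Omega>. max 0 (u x - k) *\<^sub>R grad \<eta> x)
    = - (LINT x|lebesgue_on \<Omega>. (\<eta> x * indicator {0<..} (u x - k)) *\<^sub>R g x)"
proof -
  let ?M = "lebesgue_on \<Omega>"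
  interpret finite_measure ?M
    using assms(1,2) by (rule bounded_open_finite_measure)
  define e where "e n = inverse (real (Suc n))" for n
  have e: "e n > 0" for n by (simp add: e_def)
  have cont: "continuous_on UNIV (smooth_pos (e n))" for n
    using smooth_pos_deriv[OF e] by (meson DERIV_isCont continuous_at_imp_continuous_on)
  have [measurable]: "smooth_pos (e n) \<in> borel_measurable borel" "smooth_pos' (e n) \<in> borel_measurable borel" for n
    using cont smooth_pos'_continuous[OF e] by (auto intro: borel_measurable_continuous_onI)
  have int\<eta>: "integrable ?M \<eta>" "integrable ?M (grad \<eta>)"
    using Cc_one_integrable_powr(3,4)[OF assms(1) \<eta>, of 1] by auto
  have [measurable]: "\<eta> \<in> borel_measurable ?M" "grad \<eta> \<in> borel_measurable ?M"
    "u \<in> borel_measurable ?M" "g \<in> borel_measurable ?M"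
    using int\<eta> u g by auto
  obtain B where B: "\<And>x. \<bar>\<eta> x\<bar> \<le> B" "\<And>x. norm (grad \<eta> x) \<le> B" and B0: "B > 0"
    using Cc_one_bounded[OF \<eta>] by blast
  have "(\<lambda>n. LINT x|?M. smooth_pos (e n) (u x - k) *\<^sub>R grad \<eta> x)
      \<longlonglongrightarrow> (LINT x|?M. max 0 (u x - k) *\<^sub>R grad \<eta> x)"
  proof (rule integral_dominated_convergence[where w = "\<lambda>x. \<bar>u x - k\<bar> * B"])
    show "AE x in ?M. (\<lambda>n. smooth_pos (e n) (u x - k) *\<^sub>R grad \<eta> x) \<longlonglongrightarrow> max 0 (u x - k) *\<^sub>R grad \<eta> x"
      unfolding e_def by (intro AE_I2 tendsto_intros smooth_pos_tendsto)
    show "AE x in ?M. norm (smooth_pos (e n) (u x - k) *\<^sub>R grad \<eta> x) \<le> \<bar>u x - k\<bar> * B" for n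
    proof (rule AE_I2)
      fix x
      show "norm (smooth_pos (e n) (u x - k) *\<^sub>R grad \<eta> x) \<le> \<bar>u x - k\<bar> * B"
        using smooth_pos_lipschitz[OF e, of n "u x - k" 0] B(2)[of x]
        by (auto simp: smooth_pos_0 intro!: mult_mono)
    qed
  qed (use u in auto)
  moreover have "(\<lambda>n. LINT x|?M. (\<eta> x * smooth_pos' (e n) (u x - k)) *\<^sub>R g x)
      \<longlonglongrightarrow> (LINT x|?M. (\<eta> x * indicator {0<..} (u x - k)) *\<^sub>R g x)"
  proof (rule integral_dominated_convergence[where w = "\<lambda>x. B * norm (g x)"])
    show "AE x in ?M. (\<lambda>n. (\<eta> x * smooth_pos' (e n) (u x - k)) *\<^sub>R g x)
        \<longlonglongrightarrow> (\<eta> x * indicator {0<..} (u x - k)) *\<^sub>R g x"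
      unfolding e_def by (intro AE_I2 tendsto_intros smooth_pos'_tendsto)
    show "AE x in ?M. norm ((\<eta> x * smooth_pos' (e n) (u x - k)) *\<^sub>R g x) \<le> B * norm (g x)" for n
    proof (rule AE_I2)
      fix x
      have "\<bar>\<eta> x\<bar> * smooth_pos' (e n) (u x - k) \<le> B * 1"
        using B(1)[of x] smooth_pos'_bounds[OF e, of n "u x - k"] by (intro mult_mono) auto
      then show "norm ((\<eta> x * smooth_pos' (e n) (u x - k)) *\<^sub>R g x) \<le> B * norm (g x)"
        using smooth_pos'_bounds(1)[OF e, of n "u x - k"] by (auto simp: abs_mult intro!: mult_right_mono)
    qed
  qed (use g in auto)
  ultimately show ?thesis
    using weak_gradient_smooth_pos[OF assms(1,2) e u g \<phi> lim \<eta>, of _ k]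
    by (auto intro!: LIMSEQ_unique tendsto_minus)
qed

text \<open>
  For \<open>u \<ge> 0\<close> the truncation at height \<open>k\<close> is \<open>u - max 0 (u - k)\<close>, so its weak gradient is
  \<open>g\<close> restricted to \<open>{u \<le> k}\<close>. By definition it is also \<open>v\<close> restricted to that set. Uniqueness gives
  \<open>v = g\<close> there, and these sets exhaust \<open>\<Omega>\<close> as \<open>k\<close> runs through the integers.
\<close>

lemma gen_gradient_eq_weak_gradient:
  fixes u :: "'a::euclidean_space \<Rightarrow> real"
  assumes "open \<Omega>" "bounded \<Omega>"
    and u: "integrable (lebesgue_on \<Omega>) u" and g: "integrable (lebesgue_on \<Omega>) g"
    and wg: "has_weak_gradient \<Omega> u g" and nonneg: "AE x in lebesgue_on \<Omega>. 0 \<le> u x"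
    and v: "has_gen_gradient \<Omega> u v"
    and \<phi>: "\<And>n::nat. \<phi> n \<in> Cc_one \<Omega>"
    and lim: "(\<lambda>n. LINT x|lebesgue_on \<Omega>. \<bar>\<phi> n x - u x\<bar>) \<longlonglongrightarrow> 0"
      "(\<lambda>n. LINT x|lebesgue_on \<Omega>. norm (grad (\<phi> n) x - g x)) \<longlonglongrightarrow> 0"
      "AE x in lebesgue_on \<Omega>. (\<lambda>n. \<phi> n x) \<longlonglongrightarrow> u x"
  shows "AE x in lebesgue_on \<Omega>. v x = g x"
proof -
  let ?M = "lebesgue_on \<Omega>"
  have um [measurable]: "u \<in> borel_measurable ?M" using u by auto
  have "AE x in ?M. indicator {y. \<bar>u y\<bar> \<le> k} x *\<^sub>R v x - indicator {y. \<bar>u y\<bar> \<le> k} x *\<^sub>R g x = 0"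
    if k: "k > 0" for k
  proof (rule fundamental_lemma_calculus_variations[OF assms(1)])
    let ?I = "\<lambda>x. indicat_real {y. \<bar>u y\<bar> \<le> k} x"
    have wv: "has_weak_gradient \<Omega> (\<lambda>x. trunc k (u x)) (\<lambda>x. ?I x *\<^sub>R v x)"
      using v k by (auto simp: has_gen_gradient_def)
    then have L1v: "in_L1_loc \<Omega> (\<lambda>x. ?I x *\<^sub>R v x)"
      by (simp add: has_weak_gradient_def)
    have Ig: "integrable ?M (\<lambda>x. ?I x *\<^sub>R g x)"
    proof (rule Bochner_Integration.integrable_bound[OF g])
      have "?I = (\<lambda>x. if \<bar>u x\<bar> \<le> k then 1 else 0)" by (auto simp: indicator_def)
      moreover have "(\<lambda>x. if \<bar>u x\<bar> \<le> k then 1 else 0::real) \<in> borel_measurable ?M" by measurable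
      ultimately have "?I \<in> borel_measurable ?M" by simp
      then show "(\<lambda>x. ?I x *\<^sub>R g x) \<in> borel_measurable ?M"
        using g by (intro borel_measurable_scaleR) auto
    qed (auto simp: indicator_def)
    then have L1g: "in_L1_loc \<Omega> (\<lambda>x. ?I x *\<^sub>R g x)"
      by (rule integrable_imp_in_L1_loc[OF assms(1)])
    show "in_L1_loc \<Omega> (\<lambda>x. ?I x *\<^sub>R v x - ?I x *\<^sub>R g x)"
      using L1v L1g by (auto simp: in_L1_loc_def)
    fix \<eta> assume \<eta>: "\<eta> \<in> Cc_infty \<Omega>"
    have \<eta>1: "\<eta> \<in> Cc_one \<Omega>" using Cc_infty_imp_one[OF \<eta>] .
    note I = in_L1_loc_integrable_mult[OF assms(1) _ \<eta>1]
    have int\<eta>: "integrable ?M (\<lambda>x. \<eta> x *\<^sub>R (?I x *\<^sub>R v x))" "integrable ?M (\<lambda>x. \<eta> x *\<^sub>R (?I x *\<^sub>R g x))"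
      "integrable ?M (\<lambda>x. \<eta> x *\<^sub>R g x)"
      by (rule I[OF L1v], rule I[OF L1g], rule I[OF integrable_imp_in_L1_loc[OF assms(1) g]])
    obtain B where B: "\<And>x. norm (grad \<eta> x) \<le> B" and B0: "B > 0"
      using Cc_one_bounded[OF \<eta>1] by blast
    have gm: "grad \<eta> \<in> borel_measurable ?M"
      using Cc_one_integrable_powr(4)[OF assms(1) \<eta>1, of 1] by auto
    have intu: "integrable ?M (\<lambda>x. w x *\<^sub>R grad \<eta> x)"
      if "w \<in> borel_measurable ?M" "\<And>x. \<bar>w x\<bar> \<le> \<bar>u x\<bar>" for w
    proof (rule Bochner_Integration.integrable_bound)
      show "integrable ?M (\<lambda>x. u x * B)" using u by auto
      show "(\<lambda>x. w x *\<^sub>R grad \<eta> x) \<in> borel_measurable ?M"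
        using that gm by (intro borel_measurable_scaleR)
      show "AE x in ?M. norm (w x *\<^sub>R grad \<eta> x) \<le> norm (u x * B)"
        using that B B0 by (intro AE_I2) (auto simp: abs_mult intro!: mult_mono)
    qed
    have "(LINT x|?M. \<eta> x *\<^sub>R (?I x *\<^sub>R v x)) = - (LINT x|?M. trunc k (u x) *\<^sub>R grad \<eta> x)"
      using wv \<eta> by (auto simp: has_weak_gradient_def)
    also have "(LINT x|?M. trunc k (u x) *\<^sub>R grad \<eta> x)
        = (LINT x|?M. u x *\<^sub>R grad \<eta> x - max 0 (u x - k) *\<^sub>R grad \<eta> x)"
    proof (rule integral_cong_AE)
      show "(\<lambda>x. trunc k (u x) *\<^sub>R grad \<eta> x) \<in> borel_measurable ?M"
        "(\<lambda>x. u x *\<^sub>R grad \<eta> x - max 0 (u x - k) *\<^sub>R grad \<eta> x) \<in> borel_measurable ?M"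
        using gm unfolding trunc_def by measurable
      show "AE x in ?M. trunc k (u x) *\<^sub>R grad \<eta> x
          = u x *\<^sub>R grad \<eta> x - max 0 (u x - k) *\<^sub>R grad \<eta> x"
        using nonneg k
        by (auto elim!: eventually_mono simp: trunc_def max_def min_def simp flip: scaleR_diff_left)
    qed
    also have "\<dots> = (LINT x|?M. u x *\<^sub>R grad \<eta> x) - (LINT x|?M. max 0 (u x - k) *\<^sub>R grad \<eta> x)"
      using intu[of u] intu[of "\<lambda>x. max 0 (u x - k)"] k by simp
    also have "(LINT x|?M. u x *\<^sub>R grad \<eta> x) = - (LINT x|?M. \<eta> x *\<^sub>R g x)"
      using wg \<eta> by (auto simp: has_weak_gradient_def)
    also have "(LINT x|?M. max 0 (u x - k) *\<^sub>R grad \<eta> x)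
        = - (LINT x|?M. (\<eta> x * indicator {0<..} (u x - k)) *\<^sub>R g x)"
      by (rule weak_gradient_pos_part[OF assms(1,2) u g \<phi> lim \<eta>1])
    also have "(LINT x|?M. (\<eta> x * indicator {0<..} (u x - k)) *\<^sub>R g x)
        = (LINT x|?M. \<eta> x *\<^sub>R g x - \<eta> x *\<^sub>R (?I x *\<^sub>R g x))"
    proof (rule integral_cong_AE)
      show "(\<lambda>x. (\<eta> x * indicator {0<..} (u x - k)) *\<^sub>R g x) \<in> borel_measurable ?M"
        using g Cc_one_integrable_powr(3)[OF assms(1) \<eta>1, of 1] by measurable
      show "(\<lambda>x. \<eta> x *\<^sub>R g x - \<eta> x *\<^sub>R (?I x *\<^sub>R g x)) \<in> borel_measurable ?M"
        using int\<eta> by (intro borel_measurable_diff) auto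
      show "AE x in ?M. (\<eta> x * indicator {0<..} (u x - k)) *\<^sub>R g x = \<eta> x *\<^sub>R g x - \<eta> x *\<^sub>R (?I x *\<^sub>R g x)"
        using nonneg k by (auto elim!: eventually_mono simp: indicator_def)
    qed
    also have "\<dots> = (LINT x|?M. \<eta> x *\<^sub>R g x) - (LINT x|?M. \<eta> x *\<^sub>R (?I x *\<^sub>R g x))"
      using int\<eta> by (intro Bochner_Integration.integral_diff)
    finally have "(LINT x|?M. \<eta> x *\<^sub>R (?I x *\<^sub>R v x)) = (LINT x|?M. \<eta> x *\<^sub>R (?I x *\<^sub>R g x))"
      by simp
    then show "(LINT x|?M. \<eta> x *\<^sub>R (?I x *\<^sub>R v x - ?I x *\<^sub>R g x)) = 0"
      using int\<eta> unfolding scaleR_diff_right by (subst Bochner_Integration.integral_diff) auto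
  qed
  then have "AE x in ?M. \<forall>n. indicator {y. \<bar>u y\<bar> \<le> real (Suc n)} x *\<^sub>R v x
      - indicator {y. \<bar>u y\<bar> \<le> real (Suc n)} x *\<^sub>R g x = 0"
    by (subst AE_all_countable) simp
  then show ?thesis
  proof (rule eventually_mono)
    fix x assume *: "\<forall>n. indicat_real {y. \<bar>u y\<bar> \<le> real (Suc n)} x *\<^sub>R v x
      - indicat_real {y. \<bar>u y\<bar> \<le> real (Suc n)} x *\<^sub>R g x = 0"
    obtain n where "\<bar>u x\<bar> \<le> real n" using real_arch_simple by blast
    then have "\<bar>u x\<bar> \<le> real (Suc n)" by simp
    then show "v x = g x" using *[rule_format, of n] by simp
  qed
qed

section \<open>The energy estimate\<close>

text \<open>
  The constant in \<open>s t \<le> \<delta> s\<^sup>p + C t\<^sup>q\<close> for the choice \<open>\<delta> = 1/(2 \<cdot> 2\<^sup>p (2 R p)\<^sup>p)\<close>, where \<open>2\<^sup>p\<close> stems from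
  splitting a gradient into two summands and \<open>(2 R p)\<^sup>p\<close> from Poincare's inequality.
\<close>

definition energy_const :: "real \<Rightarrow> real \<Rightarrow> real" where
  "energy_const R p = (1 / (2 * (2 powr p * (2 * R * p) powr p))) powr (- (1 / (p - 1)))"

text \<open>
  Write \<open>E\<close> for the integral of \<open>H |g|\<^sup>p\<close> with \<open>H = smooth_pos' e (\<phi> x)\<close>, and \<open>D\<close> for that of
  \<open>|\<nabla>\<phi> - g|\<^sup>p\<close>. Since the gradient of \<open>\<psi> = smooth_pos e (\<phi> x)\<close> is \<open>H \<nabla>\<phi>\<close>, the term with \<open>g\<close> is at least
  \<open>E/2\<close> up to a multiple of \<open>D\<close>; for this it matters that the error \<open>|g|\<^sup>p\<^sup>-\<^sup>1 |\<nabla>\<phi> - g|\<close> carries the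
  weight \<open>H\<close> too. The term with \<open>F\<close> is at most \<open>(E + D)/2\<close> plus a multiple of the integral of \<open>|F|\<^sup>q\<close>. In the
  difference, \<open>E\<close> cancels.
\<close>

lemma energy_test_estimate:
  fixes g :: "'a::euclidean_space \<Rightarrow> 'a" and F \<phi> :: "'a \<Rightarrow> real"
  assumes "open \<Omega>" "\<Omega> \<subseteq> cball 0 R" "R > 0" "p > 1" and e: "e > 0"
    and g: "in_Lp p \<Omega> g" and F: "in_Lp (p / (p - 1)) \<Omega> F" and \<phi>: "\<phi> \<in> Cc_one \<Omega>"
  shows "(LINT x|lebesgue_on \<Omega>. F x * smooth_pos e (\<phi> x))
      - (LINT x|lebesgue_on \<Omega>. (norm (g x) powr (p - 2) *\<^sub>R g x) \<bullet> grad (\<lambda>x. smooth_pos e (\<phi> x)) x)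
    \<le> (1/2 + (1/2) powr (1 - p)) * (LINT x|lebesgue_on \<Omega>. norm (grad \<phi> x - g x) powr p)
      + energy_const R p * (LINT x|lebesgue_on \<Omega>. \<bar>F x\<bar> powr (p / (p - 1)))"
proof -
  let ?M = "lebesgue_on \<Omega>"
  define K where "K = 2 powr p * (2 * R * p) powr p"
  define q where "q = p / (p - 1)"
  define \<psi> where "\<psi> x = smooth_pos e (\<phi> x)" for x
  define d where "d x = grad \<phi> x - g x" for x
  define H where "H x = smooth_pos' e (\<phi> x)" for x
  define V where "V x = norm (g x) powr (p - 2) *\<^sub>R g x" for x
  define \<delta> where "\<delta> = 1 / (2 * K)"
  define c where "c = \<delta> powr (- (1 / (p - 1)))"
  define c1 where "c1 = (1/2::real) powr (1 - p)"
  define E where "E = (LINT x|?M. H x * norm (g x) powr p)"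
  define D where "D = (LINT x|?M. norm (d x) powr p)"
  have K0: "K > 0" using assms by (simp add: K_def)
  have \<delta>: "\<delta> > 0" using K0 by (simp add: \<delta>_def)
  have H: "0 \<le> H x" "H x \<le> 1" for x
    using smooth_pos'_bounds[OF e] by (auto simp: H_def)
  have \<psi>: "\<psi> \<in> Cc_one \<Omega>" and gr: "grad \<psi> x = H x *\<^sub>R grad \<phi> x" and \<psi>0: "0 \<le> \<psi> x" for x
    unfolding \<psi>_def[abs_def] H_def
    using Cc_one_compose[OF \<phi> smooth_pos_deriv[OF e] smooth_pos'_continuous[OF e] smooth_pos_0]
      C1_compose_real(2)[OF Cc_one_C1[OF \<phi>] smooth_pos_deriv[OF e] smooth_pos'_continuous[OF e]]
      smooth_pos_nonneg[OF e] by auto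
  have [measurable]: "g \<in> borel_measurable ?M" "F \<in> borel_measurable ?M"
    "\<phi> \<in> borel_measurable ?M" "grad \<phi> \<in> borel_measurable ?M"
    "\<psi> \<in> borel_measurable ?M" "grad \<psi> \<in> borel_measurable ?M"
    using g F Cc_one_integrable_powr(3,4)[OF \<open>open \<Omega>\<close> \<phi>, of 1]
      Cc_one_integrable_powr(3,4)[OF \<open>open \<Omega>\<close> \<psi>, of 1] by (auto simp: in_Lp_def)
  have [measurable]: "smooth_pos' e \<in> borel_measurable borel"
    using smooth_pos'_continuous[OF e] by (rule borel_measurable_continuous_onI)
  have [measurable]: "H \<in> borel_measurable ?M" "V \<in> borel_measurable ?M"
    unfolding H_def[abs_def] V_def[abs_def] by measurable
  have "in_Lp p \<Omega> (grad \<phi>)"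
    using Cc_one_integrable_powr(2)[OF \<open>open \<Omega>\<close> \<phi>, of p] \<open>p > 1\<close> by (auto simp: in_Lp_def)
  then have intd: "integrable ?M (\<lambda>x. norm (d x) powr p)"
    using in_Lp_diff[OF _ g, of "grad \<phi>"] \<open>p > 1\<close> by (auto simp: in_Lp_def d_def)
  have intg: "integrable ?M (\<lambda>x. norm (g x) powr p)"
    using g by (simp add: in_Lp_def)
  have intF: "integrable ?M (\<lambda>x. \<bar>F x\<bar> powr q)"
    using F by (simp add: in_Lp_def q_def)
  have int\<psi>: "integrable ?M (\<lambda>x. \<psi> x powr p)" "integrable ?M (\<lambda>x. norm (grad \<psi> x) powr p)"
    using Cc_one_integrable_powr(1,2)[OF \<open>open \<Omega>\<close> \<psi>, of p] \<psi>0 \<open>p > 1\<close> by auto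
  have intE: "integrable ?M (\<lambda>x. H x * norm (g x) powr p)"
    by (rule Bochner_Integration.integrable_bound[OF intg])
       (use H in \<open>auto simp: abs_mult intro!: mult_left_le_one_le\<close>)
  have V: "norm (V x) = norm (g x) powr (p - 1)" "V x \<bullet> g x = norm (g x) powr p" for x
  proof -
    show "norm (V x) = norm (g x) powr (p - 1)"
      by (cases "g x = 0") (auto simp: V_def powr_diff power2_eq_square)
    show "V x \<bullet> g x = norm (g x) powr p"
      by (cases "g x = 0") (auto simp: V_def powr_diff dot_square_norm)
  qed
  \<comment> \<open>The coefficient one half leaves the other half of \<open>E\<close> for the term with \<open>F\<close>.\<close>
  have absorb: "norm (V x) * norm (d x) \<le> 1/2 * norm (g x) powr p + c1 * norm (d x) powr p" for x
    unfolding V c1_def using \<open>p > 1\<close> by (intro powr_absorb) auto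
  have intV: "integrable ?M (\<lambda>x. V x \<bullet> grad \<psi> x)"
  proof (rule Bochner_Integration.integrable_bound)
    show "integrable ?M (\<lambda>x. norm (g x) powr p + norm (grad \<psi> x) powr p)"
      using intg int\<psi> by auto
    show "AE x in ?M. norm (V x \<bullet> grad \<psi> x) \<le> norm (norm (g x) powr p + norm (grad \<psi> x) powr p)"
    proof (rule AE_I2)
      fix x
      have "\<bar>V x \<bullet> grad \<psi> x\<bar> \<le> norm (g x) powr (p - 1) * norm (grad \<psi> x)"
        using Cauchy_Schwarz_ineq2[of "V x" "grad \<psi> x"] by (simp add: V)
      also have "\<dots> \<le> 1 * norm (g x) powr p + 1 powr (1 - p) * norm (grad \<psi> x) powr p"
        using \<open>p > 1\<close> by (intro powr_absorb) auto
      finally show "norm (V x \<bullet> grad \<psi> x) \<le> norm (norm (g x) powr p + norm (grad \<psi> x) powr p)"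
        by simp
    qed
  qed measurable
  have "1/2 * E - c1 * D = (LINT x|?M. 1/2 * (H x * norm (g x) powr p) - c1 * norm (d x) powr p)"
    using intE intd by (simp add: E_def D_def)
  also have "\<dots> \<le> (LINT x|?M. V x \<bullet> grad \<psi> x)"
  proof (rule integral_mono[OF _ intV])
    show "integrable ?M (\<lambda>x. 1/2 * (H x * norm (g x) powr p) - c1 * norm (d x) powr p)"
      using intE intd by auto
    fix x
    have "norm (g x) powr p - norm (V x) * norm (d x) \<le> V x \<bullet> grad \<phi> x"
      using Cauchy_Schwarz_ineq2[of "V x" "d x"] by (simp add: d_def V inner_diff_right)
    then have "1/2 * norm (g x) powr p - c1 * norm (d x) powr p \<le> V x \<bullet> grad \<phi> x"
      using absorb[of x] by linarith
    then have "H x * (1/2 * norm (g x) powr p - c1 * norm (d x) powr p) \<le> H x * (V x \<bullet> grad \<phi> x)"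
      using H by (intro mult_left_mono)
    moreover have "H x * (c1 * norm (d x) powr p) \<le> c1 * norm (d x) powr p"
      using H by (intro mult_left_le_one_le) (auto simp: c1_def)
    ultimately show "1/2 * (H x * norm (g x) powr p) - c1 * norm (d x) powr p \<le> V x \<bullet> grad \<psi> x"
      unfolding gr by (simp add: right_diff_distrib)
  qed
  finally have lower: "1/2 * E - c1 * D \<le> (LINT x|?M. V x \<bullet> grad \<psi> x)" .
  have conj: "\<bar>F x\<bar> * \<psi> x \<le> \<delta> * \<psi> x powr p + c * \<bar>F x\<bar> powr q" for x
    using powr_absorb_conjugate[OF \<delta> \<psi>0 abs_ge_zero \<open>p > 1\<close>, of x "F x"]
    by (simp add: c_def q_def mult.commute)
  have "(LINT x|?M. norm (grad \<psi> x) powr p)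
      \<le> (LINT x|?M. 2 powr p * (H x * norm (g x) powr p + norm (d x) powr p))"
  proof (rule integral_mono[OF int\<psi>(2)])
    show "integrable ?M (\<lambda>x. 2 powr p * (H x * norm (g x) powr p + norm (d x) powr p))"
      using intE intd by auto
    fix x
    have "norm (grad \<psi> x) powr p = norm (H x *\<^sub>R g x + H x *\<^sub>R d x) powr p"
      by (simp add: gr d_def flip: scaleR_add_right)
    also have "\<dots> \<le> 2 powr p * (norm (H x *\<^sub>R g x) powr p + norm (H x *\<^sub>R d x) powr p)"
      using \<open>p > 1\<close> by (intro powr_norm_add_le) auto
    also have "\<dots> \<le> 2 powr p * (H x * norm (g x) powr p + norm (d x) powr p)"
    proof (intro mult_left_mono add_mono)
      \<comment> \<open>Weights in \<open>[0, 1]\<close> may be raised to powers, so \<open>E\<close> with its weight \<open>H\<close> to the first power suffices.\<close>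
      have "H x powr p \<le> H x"
        using powr_mono'[of 1 p "H x"] H[of x] \<open>p > 1\<close> by simp
      then show "norm (H x *\<^sub>R g x) powr p \<le> H x * norm (g x) powr p"
        using H[of x] by (simp add: powr_mult mult_right_mono)
      show "norm (H x *\<^sub>R d x) powr p \<le> norm (d x) powr p"
        using H[of x] \<open>p > 1\<close> by (intro powr_mono2) (auto intro: mult_left_le_one_le)
    qed auto
    finally show "norm (grad \<psi> x) powr p \<le> 2 powr p * (H x * norm (g x) powr p + norm (d x) powr p)" .
  qed
  also have "\<dots> = 2 powr p * (E + D)"
    using intE intd by (simp add: E_def D_def)
  finally have gradb: "(LINT x|?M. norm (grad \<psi> x) powr p) \<le> 2 powr p * (E + D)" .
  have "(LINT x|?M. F x * \<psi> x) \<le> (LINT x|?M. \<delta> * \<psi> x powr p + c * \<bar>F x\<bar> powr q)"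
  proof (rule integral_mono)
    show int: "integrable ?M (\<lambda>x. \<delta> * \<psi> x powr p + c * \<bar>F x\<bar> powr q)"
      using int\<psi> intF by auto
    show "integrable ?M (\<lambda>x. F x * \<psi> x)"
      by (rule Bochner_Integration.integrable_bound[OF int])
         (use conj \<psi>0 in \<open>auto simp: abs_mult intro: order_trans[OF _ abs_ge_self]\<close>)
    fix x
    have "F x * \<psi> x \<le> \<bar>F x\<bar> * \<psi> x" using \<psi>0[of x] by (intro mult_right_mono) auto
    then show "F x * \<psi> x \<le> \<delta> * \<psi> x powr p + c * \<bar>F x\<bar> powr q" using conj[of x] by linarith
  qed
  also have "\<dots> = \<delta> * (LINT x|?M. \<psi> x powr p) + c * (LINT x|?M. \<bar>F x\<bar> powr q)"
    using int\<psi> intF by simp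
  also have "\<delta> * (LINT x|?M. \<psi> x powr p) \<le> \<delta> * ((2 * R * p) powr p * (2 powr p * (E + D)))"
  proof (intro mult_left_mono order_trans[OF Poincare_inequality[OF assms(1-4) \<psi> \<psi>0]] gradb)
    show "0 \<le> \<delta>" using \<delta> by simp
  qed auto
  also have "\<dots> = 1/2 * (E + D)"
  proof -
    have "\<delta> * ((2 * R * p) powr p * (2 powr p * (E + D))) = (\<delta> * K) * (E + D)"
      by (simp only: K_def mult_ac)
    then show ?thesis using K0 by (simp add: \<delta>_def)
  qed
  finally have "(LINT x|?M. F x * \<psi> x) \<le> 1/2 * (E + D) + c * (LINT x|?M. \<bar>F x\<bar> powr q)"
    by simp
  then have "(LINT x|?M. F x * \<psi> x) - (LINT x|?M. V x \<bullet> grad \<psi> x)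
      \<le> (1/2 + c1) * D + c * (LINT x|?M. \<bar>F x\<bar> powr q)"
    using lower distrib_right[of "1/2" c1 D] distrib_left[of "1/2" E D] by linarith
  then show ?thesis
    by (simp add: \<psi>_def[abs_def] V_def D_def d_def c_def c1_def q_def \<delta>_def energy_const_def K_def)
qed

section \<open>The singular term\<close>

lemma sing_quot_measurable:
  assumes [measurable]: "a \<in> borel_measurable M" "u \<in> borel_measurable M"
  shows "sing_quot a u \<in> borel_measurable M"
  unfolding sing_quot_def[abs_def] by measurable

lemma sing_quot_in_L1_loc:
  assumes "sing_quot a u \<in> borel_measurable (lebesgue_on \<Omega>)"
    and fin: "\<And>K. compact K \<Longrightarrow> K \<subseteq> \<Omega> \<Longrightarrow> (\<integral>\<^sup>+x. sing_quot a u x \<partial>lebesgue_on K) < \<infinity>"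
  shows "in_L1_loc \<Omega> (\<lambda>x. enn2real (sing_quot a u x))"
  unfolding in_L1_loc_def
proof (intro conjI allI impI)
  show "(\<lambda>x. enn2real (sing_quot a u x)) \<in> borel_measurable (lebesgue_on \<Omega>)"
    using assms(1) by measurable
  fix K assume K: "compact K \<and> K \<subseteq> \<Omega>"
  have [measurable]: "sing_quot a u \<in> borel_measurable (lebesgue_on K)"
    using assms(1) K measurable_restrict_mono by blast
  show "integrable (lebesgue_on K) (\<lambda>x. enn2real (sing_quot a u x))"
  proof (rule integrableI_bounded)
    have "(\<integral>\<^sup>+x. ennreal (norm (enn2real (sing_quot a u x))) \<partial>lebesgue_on K)
        \<le> (\<integral>\<^sup>+x. sing_quot a u x \<partial>lebesgue_on K)"
      by (intro nn_integral_mono) (simp add: ennreal_enn2real_if)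
    then show "(\<integral>\<^sup>+x. ennreal (norm (enn2real (sing_quot a u x))) \<partial>lebesgue_on K) < \<infinity>"
      using fin[of K] K by (auto intro: le_less_trans)
  qed measurable
qed

lemma sing_quot_finite_AE:
  fixes \<Omega> :: "'a::euclidean_space set"
  assumes "open \<Omega>" "sing_quot a u \<in> borel_measurable (lebesgue_on \<Omega>)"
    and fin: "\<And>K. compact K \<Longrightarrow> K \<subseteq> \<Omega> \<Longrightarrow> (\<integral>\<^sup>+x. sing_quot a u x \<partial>lebesgue_on K) < \<infinity>"
  shows "AE x in lebesgue_on \<Omega>. sing_quot a u x \<noteq> \<infinity>"
proof -
  obtain \<D> where D: "countable \<D>" "\<D> \<subseteq> Pow \<Omega>"
    "\<And>X. X \<in> \<D> \<Longrightarrow> \<exists>l r. X = cbox l r" "\<Union>\<D> = \<Omega>"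
    using open_countable_Union_open_cbox[OF \<open>open \<Omega>\<close>] by blast
  have "AE x in lebesgue. x \<in> X \<longrightarrow> sing_quot a u x \<noteq> \<infinity>" if X: "X \<in> \<D>" for X
  proof -
    have "compact X" "X \<subseteq> \<Omega>" using D X compact_cbox by blast+
    moreover have "sing_quot a u \<in> borel_measurable (lebesgue_on X)"
      using assms(2) \<open>X \<subseteq> \<Omega>\<close> measurable_restrict_mono by blast
    ultimately have "AE x in lebesgue_on X. sing_quot a u x \<noteq> \<infinity>"
      using fin[of X] by (intro nn_integral_PInf_AE) auto
    moreover have "X \<in> sets lebesgue" using \<open>compact X\<close> lmeasurable_compact fmeasurableD by blast
    ultimately show ?thesis by (simp add: AE_lebesgue_on_iff)
  qed
  then have "AE x in lebesgue. \<forall>X\<in>\<D>. x \<in> X \<longrightarrow> sing_quot a u x \<noteq> \<infinity>"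
    using AE_ball_countable[OF D(1), of "\<lambda>x X. x \<in> X \<longrightarrow> sing_quot a u x \<noteq> \<infinity>" lebesgue] by blast
  then have "AE x in lebesgue. x \<in> \<Omega> \<longrightarrow> sing_quot a u x \<noteq> \<infinity>"
    by (rule eventually_mono) (use D(4) in blast)
  then show ?thesis using \<open>open \<Omega>\<close> by (simp add: AE_lebesgue_on_iff)
qed

text \<open>
  Finiteness of the quotient excludes \<open>u x = 0 < a x\<close>, and when both vanish the quotient is \<open>0\<close>.
\<close>

lemma sing_quot_mult:
  assumes "sing_quot a u x \<noteq> \<infinity>" "0 \<le> a x" "0 \<le> u x"
  shows "enn2real (sing_quot a u x) * u x = a x"
proof -
  consider "a x = 0" | "a x > 0" "u x = 0" | "a x > 0" "u x > 0"
    using assms(2,3) by linarith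
  then show ?thesis
  proof cases
    case 1
    then show ?thesis using sing_quot_simps(2)[of a x u] by simp
  next
    case 2
    then show ?thesis using assms(1) sing_quot_simps(1)[of a x u] by simp
  next
    case 3
    then show ?thesis using sing_quot_simps(3)[of a x u] by simp
  qed
qed

text \<open>
  With \<open>\<psi> n\<close> as test function, the singular term \<open>A n\<close> equals the left-hand side of the energy
  estimate for \<open>F = \<mu> f\<close>, and the bound \<open>B n\<close> converges because the \<open>\<phi> n\<close> converge in \<open>W\<^sup>1\<^sup>,\<^sup>p\<close>.
  Almost everywhere the integrand of \<open>A n\<close> is nonnegative and converges to \<open>(a/u) u = a\<close>, so
  Fatou's lemma applies.
\<close>

lemma integral_coefficient_bound:
  fixes u :: "'a::euclidean_space \<Rightarrow> real"
  assumes "open \<Omega>" "\<Omega> \<subseteq> cball 0 R" "R > 0" "p > 1"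
    and a: "integrable (lebesgue_on \<Omega>) a" "AE x in lebesgue_on \<Omega>. 0 \<le> a x"
    and f: "in_Lp (p / (p - 1)) \<Omega> f"
    and sol: "is_finite_energy_solution p \<Omega> a f \<mu> u"
  shows "(LINT x|lebesgue_on \<Omega>. a x)
    \<le> energy_const R p * (LINT x|lebesgue_on \<Omega>. \<bar>\<mu> * f x\<bar> powr (p / (p - 1)))"
    (is "_ \<le> ?\<beta>")
proof -
  let ?M = "lebesgue_on \<Omega>"
  have bdd: "bounded \<Omega>" using \<open>\<Omega> \<subseteq> cball 0 R\<close> bounded_cball bounded_subset by blast
  have W: "in_W1_0 p \<Omega> u" and u0: "AE x in ?M. 0 \<le> u x"
    and um [measurable]: "u \<in> borel_measurable ?M"
    and fin: "\<And>K. compact K \<Longrightarrow> K \<subseteq> \<Omega> \<Longrightarrow> (\<integral>\<^sup>+x. sing_quot a u x \<partial>lebesgue_on K) < \<infinity>"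
    using sol by (auto simp: is_finite_energy_solution_def is_solution_def)
  obtain v where v: "has_gen_gradient \<Omega> u v" and
    eq: "\<And>\<phi>. \<phi> \<in> Cc_one \<Omega> \<Longrightarrow>
           (LINT x|?M. (norm (v x) powr (p - 2) *\<^sub>R v x) \<bullet> grad \<phi> x)
           + (LINT x|?M. enn2real (sing_quot a u x) * \<phi> x) = \<mu> * (LINT x|?M. f x * \<phi> x)"
    using sol by (auto simp: is_finite_energy_solution_def is_solution_def)
  obtain g \<phi> where g: "has_weak_gradient \<Omega> u g" "in_Lp p \<Omega> u" "in_Lp p \<Omega> g"
    and \<phi>: "\<And>n::nat. \<phi> n \<in> Cc_one \<Omega>"
    and lim: "(\<lambda>n. LINT x|?M. \<bar>\<phi> n x - u x\<bar>) \<longlonglongrightarrow> 0"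
      "(\<lambda>n. LINT x|?M. norm (grad (\<phi> n) x - g x)) \<longlonglongrightarrow> 0"
    and limp: "(\<lambda>n. LINT x|?M. norm (grad (\<phi> n) x - g x) powr p) \<longlonglongrightarrow> 0"
    and limAE: "AE x in ?M. (\<lambda>n. \<phi> n x) \<longlonglongrightarrow> u x"
    using in_W1_0_approximation[OF \<open>open \<Omega>\<close> bdd \<open>p > 1\<close> W] by blast
  have int: "integrable ?M u" "integrable ?M g"
    using in_Lp_integrable[OF \<open>open \<Omega>\<close> bdd g(2)] in_Lp_integrable[OF \<open>open \<Omega>\<close> bdd g(3)] \<open>p > 1\<close> by auto
  have vg: "AE x in ?M. v x = g x"
    by (rule gen_gradient_eq_weak_gradient[OF \<open>open \<Omega>\<close> bdd int g(1) u0 v \<phi> lim limAE])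
  have [measurable]: "v \<in> borel_measurable ?M" "g \<in> borel_measurable ?M"
    using v int by (auto simp: has_gen_gradient_def)
  have sq: "sing_quot a u \<in> borel_measurable ?M"
    using a(1) by (intro sing_quot_measurable) auto
  define S where "S x = enn2real (sing_quot a u x)" for x
  have S0: "0 \<le> S x" for x by (simp add: S_def)
  have SL: "in_L1_loc \<Omega> S"
    unfolding S_def[abs_def] by (rule sing_quot_in_L1_loc[OF sq fin])
  have Su: "AE x in ?M. S x * u x = a x"
  proof -
    have "AE x in ?M. sing_quot a u x \<noteq> \<infinity>"
      by (rule sing_quot_finite_AE[OF \<open>open \<Omega>\<close> sq fin])
    then show ?thesis
      using a(2) u0 by eventually_elim (simp add: S_def sing_quot_mult)
  qed
  define e where "e n = inverse (real (Suc n))" for n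
  have e: "e n > 0" for n by (simp add: e_def)
  define \<psi> where "\<psi> n x = smooth_pos (e n) (\<phi> n x)" for n x
  have \<psi>: "\<psi> n \<in> Cc_one \<Omega>" and \<psi>0: "0 \<le> \<psi> n x" for n x
    unfolding \<psi>_def[abs_def]
    using Cc_one_compose[OF \<phi> smooth_pos_deriv[OF e] smooth_pos'_continuous[OF e] smooth_pos_0]
      smooth_pos_nonneg[OF e] by auto
  define A where "A n = (LINT x|?M. S x * \<psi> n x)" for n
  define B where "B n = (1/2 + (1/2) powr (1 - p)) * (LINT x|?M. norm (grad (\<phi> n) x - g x) powr p) + ?\<beta>" for n
  have intS: "integrable ?M (\<lambda>x. S x * \<psi> n x)" for n
    using in_L1_loc_integrable_mult[OF \<open>open \<Omega>\<close> SL \<psi>, of n] by (simp add: mult.commute)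
  have AB: "A n \<le> B n" for n
  proof -
    have "(LINT x|?M. (norm (v x) powr (p - 2) *\<^sub>R v x) \<bullet> grad (\<psi> n) x)
        = (LINT x|?M. (norm (g x) powr (p - 2) *\<^sub>R g x) \<bullet> grad (\<psi> n) x)"
    proof (rule integral_cong_AE)
      have [measurable]: "grad (\<psi> n) \<in> borel_measurable ?M"
        using Cc_one_integrable_powr(4)[OF \<open>open \<Omega>\<close> \<psi>, of 1] by auto
      show "(\<lambda>x. (norm (v x) powr (p - 2) *\<^sub>R v x) \<bullet> grad (\<psi> n) x) \<in> borel_measurable ?M"
        "(\<lambda>x. (norm (g x) powr (p - 2) *\<^sub>R g x) \<bullet> grad (\<psi> n) x) \<in> borel_measurable ?M"
        by measurable
      show "AE x in ?M. (norm (v x) powr (p - 2) *\<^sub>R v x) \<bullet> grad (\<psi> n) x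
          = (norm (g x) powr (p - 2) *\<^sub>R g x) \<bullet> grad (\<psi> n) x"
        using vg by eventually_elim simp
    qed
    then have "A n = (LINT x|?M. (\<mu> * f x) * \<psi> n x)
        - (LINT x|?M. (norm (g x) powr (p - 2) *\<^sub>R g x) \<bullet> grad (\<psi> n) x)"
      using eq[OF \<psi>, of n] by (simp add: A_def S_def mult.assoc)
    also have "\<dots> \<le> B n"
    proof -
      have "in_Lp (p / (p - 1)) \<Omega> (\<lambda>x. \<mu> * f x)"
        using f by (auto simp: in_Lp_def abs_mult powr_mult)
      from energy_test_estimate[OF assms(1-4) e g(3) this \<phi>]
      show ?thesis unfolding B_def \<psi>_def .
    qed
    finally show ?thesis .
  qed
  have "B \<longlonglongrightarrow> (1/2 + (1/2) powr (1 - p)) * 0 + ?\<beta>"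
    unfolding B_def by (intro tendsto_intros limp)
  then have Blim: "B \<longlonglongrightarrow> ?\<beta>" by simp
  have conv: "AE x in ?M. (\<lambda>n. ennreal (S x * \<psi> n x)) \<longlonglongrightarrow> ennreal (a x)"
    using limAE Su u0
  proof eventually_elim
    case (elim x)
    have "(\<lambda>n. \<psi> n x - max 0 (\<phi> n x)) \<longlonglongrightarrow> 0"
      unfolding \<psi>_def using smooth_pos_approx[OF e]
      by (intro Lim_null_comparison[OF _ LIMSEQ_inverse_real_of_nat] always_eventually)
         (simp add: e_def)
    moreover have "(\<lambda>n. max 0 (\<phi> n x)) \<longlonglongrightarrow> max 0 (u x)"
      using elim by (intro tendsto_intros)
    ultimately have "(\<lambda>n. \<psi> n x) \<longlonglongrightarrow> u x"
      using tendsto_add[of "\<lambda>n. \<psi> n x - max 0 (\<phi> n x)" 0 _ "\<lambda>n. max 0 (\<phi> n x)" "max 0 (u x)"] elim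
      by simp
    then have "(\<lambda>n. ennreal (S x * \<psi> n x)) \<longlonglongrightarrow> ennreal (S x * u x)"
      by (intro tendsto_ennrealI tendsto_intros)
    then show ?case using elim by simp
  qed
  have "ennreal (LINT x|?M. a x) = (\<integral>\<^sup>+x. ennreal (a x) \<partial>?M)"
    using a by (simp add: nn_integral_eq_integral)
  also have "\<dots> = (\<integral>\<^sup>+x. liminf (\<lambda>n. ennreal (S x * \<psi> n x)) \<partial>?M)"
    using conv by (intro nn_integral_cong_AE) (auto elim!: eventually_mono simp: lim_imp_Liminf)
  also have "\<dots> \<le> liminf (\<lambda>n. \<integral>\<^sup>+x. ennreal (S x * \<psi> n x) \<partial>?M)"
    using intS by (intro nn_integral_liminf) auto
  also have "(\<lambda>n. \<integral>\<^sup>+x. ennreal (S x * \<psi> n x) \<partial>?M) = (\<lambda>n. ennreal (A n))"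
    using intS S0 \<psi>0 by (simp add: nn_integral_eq_integral A_def)
  also have "liminf (\<lambda>n. ennreal (A n)) \<le> liminf (\<lambda>n. ennreal (B n))"
    using AB by (intro Liminf_mono always_eventually) (auto intro: ennreal_leI)
  also have "\<dots> = ennreal ?\<beta>"
    using Blim by (intro lim_imp_Liminf tendsto_ennrealI) auto
  finally show ?thesis
    by (subst (asm) ennreal_le_iff) (auto simp: energy_const_def intro!: mult_nonneg_nonneg Bochner_Integration.integral_nonneg)
qed

theorem theorem4p2:
  fixes \<Omega> :: "'a::euclidean_space set"
    and p :: real
    and a f :: "'a \<Rightarrow> real"
  assumes "DIM('a) \<ge> 2"
    and "open \<Omega>" and "bounded \<Omega>" and "smooth_boundary \<Omega>"
    and "p > 1"
    and "in_Lp 1 \<Omega> a"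
    and "AE x in lebesgue_on \<Omega>. 0 \<le> a x"
    and "\<not> (AE x in lebesgue_on \<Omega>. a x = 0)"
    and "in_Lp (p / (p - 1)) \<Omega> f"
  shows "\<exists>\<mu>0>0. \<forall>\<mu>. 0 < \<mu> \<and> \<mu> \<le> \<mu>0 \<longrightarrow>
    \<not> (\<exists>u. is_finite_energy_solution p \<Omega> a f \<mu> u \<and> \<not> (AE x in lebesgue_on \<Omega>. u x = 0))"
proof -
  let ?M = "lebesgue_on \<Omega>"
  define q where "q = p / (p - 1)"
  have q: "q > 1" using \<open>p > 1\<close> by (simp add: q_def)
  obtain R where R: "R > 0" "\<Omega> \<subseteq> cball 0 R"
    using \<open>bounded \<Omega>\<close> unfolding bounded_pos by (force simp: subset_iff)
  have inta: "integrable ?M a"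
    using in_Lp_integrable[OF \<open>open \<Omega>\<close> \<open>bounded \<Omega>\<close> \<open>in_Lp 1 \<Omega> a\<close>] by simp
  have a0: "(LINT x|?M. a x) > 0"
    using integral_nonneg_eq_0_iff_AE[OF inta assms(7)] integral_nonneg_AE[OF assms(7)] assms(8)
    by linarith
  define c where "c = energy_const R p"
  define I where "I = c * (LINT x|?M. \<bar>f x\<bar> powr q)"
  have I0: "I \<ge> 0"
    unfolding I_def c_def energy_const_def by (intro mult_nonneg_nonneg Bochner_Integration.integral_nonneg) auto
  define \<mu>0 where "\<mu>0 = min 1 ((LINT x|?M. a x) / (2 * (I + 1)))"
  have "\<not> is_finite_energy_solution p \<Omega> a f \<mu> u" if \<mu>: "0 < \<mu>" "\<mu> \<le> \<mu>0" for \<mu> u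
  proof
    assume "is_finite_energy_solution p \<Omega> a f \<mu> u"
    then have "(LINT x|?M. a x) \<le> c * (LINT x|?M. \<bar>\<mu> * f x\<bar> powr q)"
      unfolding c_def q_def
      by (rule integral_coefficient_bound[OF \<open>open \<Omega>\<close> R(2,1) \<open>p > 1\<close> inta assms(7,9)])
    also have "\<dots> = \<mu> powr q * I"
      using \<mu> by (simp add: I_def abs_mult powr_mult)
    \<comment> \<open>Here \<open>\<mu> \<le> 1\<close> is used; the next step uses the other bound in \<open>\<mu>0\<close>.\<close>
    also have "\<dots> \<le> \<mu> * I"
      using powr_mono'[of 1 q \<mu>] q \<mu> I0 by (intro mult_right_mono) (auto simp: \<mu>0_def)
    also have "\<dots> \<le> (LINT x|?M. a x) / (2 * (I + 1)) * (I + 1)"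
      using \<mu> I0 by (intro mult_mono) (auto simp: \<mu>0_def)
    also have "\<dots> < (LINT x|?M. a x)"
    proof -
      have "x / (2 * J) * J = x / 2" if "J \<noteq> 0" for x J :: real
        using that by simp
      from this[of "I + 1" "LINT x|?M. a x"]
      have half: "(LINT x|?M. a x) / (2 * (I + 1)) * (I + 1) = (LINT x|?M. a x) / 2"
        using I0 by linarith
      show ?thesis unfolding half using a0 by simp
    qed
    finally show False by simp
  qed
  moreover have "\<mu>0 > 0" using a0 I0 by (simp add: \<mu>0_def)
  ultimately show ?thesis by blast
qed

end
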